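(* Let $q\in k$ be a primitive $48$-th root of unity. The generalised Taft algebras $H:=H_q\left(\begin{smallmatrix}34&26\\4&4\end{smallmatrix}\right)$ and $L:=H_q\left(\begin{smallmatrix}34&26\\28&4\end{smallmatrix}\right)$ (with parameter matrices in $\mathbb Z_{48}^{2\times 2}$) are isomorphic as algebras, but only $L$ admits a pair in involution (that is, $L$ has a pair in involution and $H$ has none).
   Context: $k$ is an algebraically closed field of characteristic zero; $\mathbb Z_N=\mathbb Z/N\mathbb Z$. Pair in involution: for a Hopf algebra $H$ over $k$ with antipode $S$, a pair $(l,\beta)$ of a group-like element $l\in H$ and a group-like element $\beta$ of the finite dual $H^\circ$ (i.e. a character $\beta:H\to k$) with $S^2(h)=\beta(h_{(3)})\,\beta^{-1}(h_{(1)})\; l\,h_{(2)}\,l^{-1}$ for all $h\in H$ (Sweedler notation, $\beta^{-1}=\beta\circ S$). Generalised Taft algebra $H_q(a_{ij})$: let $N\ge2$, $q\in k$ a primitive $N$-th root of unity, and $(a_{ij})\in\mathbb Z_N^{2\times2}$ a parameter matrix, i.e. $a_{11}a_{12}\neq0$, $a_{21}a_{22}\ne0$, $a_{11}a_{22}+a_{12}a_{21}=0$ in $\mathbb Z_N$. Let $N_x$ and $N_y$ be the additive orders of $a_{11}a_{12}$ and $a_{21}a_{22}$ in $\mathbb Z_N$. Then $H_q(a_{ij})$ is the Hopf algebra over $k$ generated by $g,x,y$ subject to $x^{N_x}=0$, $y^{N_y}=0$, $xy=q^{a_{11}a_{22}}yx$, $g^N=1$, $gx=q^{a_{12}}xg$,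 $gy=q^{a_{22}}yg$, with coproduct $\Delta(g)=g\otimes g$, $\Delta(x)=1\otimes x+x\otimes g^{a_{11}}$, $\Delta(y)=1\otimes y+y\otimes g^{a_{21}}$ and antipode $S(g)=g^{-1}$, $S(x)=-xg^{-a_{11}}$, $S(y)=-yg^{-a_{21}}$. Here $N=48$. *)

theory Defs
  imports "HOL-Algebra.Algebra" "HOL-Algebra.Algebraic_Closure_Type" "HOL-Library.Poly_Mapping"
    "HOL-Computational_Algebra.Polynomial"
begin

section \<open>Algebras over a field given as a type\<close>

text \<open>
  An algebra over the field \<open>'k\<close> is a record \<open>('k, 'a) module\<close>: a ring record together with
  a scalar multiplication by elements of \<open>'k\<close>.
\<close>

definition field_algebra :: "('k::field, 'k) module" where
  "field_algebra = ring.extend ring_of_type_algebra (module.fields (*))"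

definition algebra_hom ::
    "('k, 'a, 'm) module_scheme \<Rightarrow> ('k, 'b, 'n) module_scheme \<Rightarrow> ('a \<Rightarrow> 'b) set" where
  "algebra_hom A B =
     {\<phi> \<in> ring_hom A B. \<forall>c. \<forall>a \<in> carrier A. \<phi> (c \<odot>\<^bsub>A\<^esub> a) = c \<odot>\<^bsub>B\<^esub> \<phi> a}"

definition algebra_isomorphic ::
    "('k, 'a, 'm) module_scheme \<Rightarrow> ('k, 'b, 'n) module_scheme \<Rightarrow> bool" where
  "algebra_isomorphic A B \<longleftrightarrow> (\<exists>\<phi> \<in> algebra_hom A B. bij_betw \<phi> (carrier A) (carrier B))"

definition opposite :: "('k, 'a, 'm) module_scheme \<Rightarrow> ('k, 'a, 'm) module_scheme" where
  "opposite A = A\<lparr>mult := \<lambda>a b. b \<otimes>\<^bsub>A\<^esub> a\<rparr>"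

definition quotient_algebra ::
    "('k, 'a, 'm) module_scheme \<Rightarrow> 'a set \<Rightarrow> ('k, 'a set) module" where
  "quotient_algebra A I =
     ring.extend (A Quot I) (module.fields (\<lambda>c C. \<Union>a\<in>C. I +>\<^bsub>A\<^esub> (c \<odot>\<^bsub>A\<^esub> a)))"

text \<open>
  The value on a coset of a map that is constant on cosets; unspecified if the map is not
  constant on the coset.
\<close>

definition descend :: "('a \<Rightarrow> 'b) \<Rightarrow> 'a set \<Rightarrow> 'b" where
  "descend f C = the_elem (f ` C)"

text \<open>
  The monoid algebra: formal \<open>'k\<close>-linear combinations of elements of a monoid, multiplied
  bilinearly.  As a vector space it is free on the carrier of the monoid.
\<close>

definition monoid_algebra :: "('m, 'z) monoid_scheme \<Rightarrow> ('k::field, 'm \<Rightarrow>\<^sub>0 'k) module" where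
  "monoid_algebra M =
     \<lparr>carrier = {p. Poly_Mapping.keys p \<subseteq> carrier M},
      monoid.mult = (\<lambda>p r. \<Sum>u\<in>Poly_Mapping.keys p. \<Sum>v\<in>Poly_Mapping.keys r.
        Poly_Mapping.single (u \<otimes>\<^bsub>M\<^esub> v) (Poly_Mapping.lookup p u * Poly_Mapping.lookup r v)),
      one = Poly_Mapping.single \<one>\<^bsub>M\<^esub> 1,
      ring.zero = 0,
      add = (+),
      module.smult = (\<lambda>c. Poly_Mapping.map ((*) c))\<rparr>"

definition linear_extension ::
    "('k::field, 'u, 'n) module_scheme \<Rightarrow> ('m \<Rightarrow> 'u) \<Rightarrow> ('m \<Rightarrow>\<^sub>0 'k) \<Rightarrow> 'u" where
  "linear_extension U f p =
     finsum U (\<lambda>w. Poly_Mapping.lookup p w \<odot>\<^bsub>U\<^esub> f w) (Poly_Mapping.keys p)"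

section \<open>The tensor product of two algebras\<close>

definition bilinearity_relations ::
    "('k::field, 'a, 'm) module_scheme \<Rightarrow> ('k, 'b, 'n) module_scheme \<Rightarrow> (('a \<times> 'b) \<Rightarrow>\<^sub>0 'k) set" where
  "bilinearity_relations A B =
     {Poly_Mapping.single (a \<oplus>\<^bsub>A\<^esub> a', b) 1 - Poly_Mapping.single (a, b) 1
        - Poly_Mapping.single (a', b) 1 |
        a a' b. a \<in> carrier A \<and> a' \<in> carrier A \<and> b \<in> carrier B}
   \<union> {Poly_Mapping.single (a, b \<oplus>\<^bsub>B\<^esub> b') 1 - Poly_Mapping.single (a, b) 1
        - Poly_Mapping.single (a, b') 1 |
        a b b'. a \<in> carrier A \<and> b \<in> carrier B \<and> b' \<in> carrier B}
   \<union> {Poly_Mapping.single (c \<odot>\<^bsub>A\<^esub> a, b) 1 - Poly_Mapping.single (a, b) c |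
        c a b. a \<in> carrier A \<and> b \<in> carrier B}
   \<union> {Poly_Mapping.single (a, c \<odot>\<^bsub>B\<^esub> b) 1 - Poly_Mapping.single (a, b) c |
        c a b. a \<in> carrier A \<and> b \<in> carrier B}"

definition tensor_kernel ::
    "('k::field, 'a, 'm) module_scheme \<Rightarrow> ('k, 'b, 'n) module_scheme \<Rightarrow> (('a \<times> 'b) \<Rightarrow>\<^sub>0 'k) set" where
  "tensor_kernel A B =
     (\<lambda>W. submodule W (ring_of_type_algebra :: 'k ring) (monoid_algebra (A \<times>\<times> B)))
       hull bilinearity_relations A B"

text \<open>
  \<open>A \<otimes> B\<close>: the free vector space on pairs modulo the span of the bilinearity relations.  This
  span is a two-sided ideal of the monoid algebra of \<open>A \<times>\<times> B\<close>, so the quotient carries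
  the usual product \<open>(a \<otimes> b) (a' \<otimes> b') = a a' \<otimes> b b'\<close>.
\<close>

definition tensor_algebra ::
    "('k::field, 'a, 'm) module_scheme \<Rightarrow> ('k, 'b, 'n) module_scheme
      \<Rightarrow> ('k, (('a \<times> 'b) \<Rightarrow>\<^sub>0 'k) set) module" where
  "tensor_algebra A B = quotient_algebra (monoid_algebra (A \<times>\<times> B)) (tensor_kernel A B)"

definition pure_tensor ::
    "('k::field, 'a, 'm) module_scheme \<Rightarrow> ('k, 'b, 'n) module_scheme \<Rightarrow> 'a \<Rightarrow> 'b
      \<Rightarrow> (('a \<times> 'b) \<Rightarrow>\<^sub>0 'k) set" where
  "pure_tensor A B a b =
     tensor_kernel A B +>\<^bsub>monoid_algebra (A \<times>\<times> B)\<^esub> Poly_Mapping.single (a, b) 1"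

text \<open>The linear map \<open>A \<otimes> B \<rightarrow> U\<close> induced by a bilinear map \<open>f\<close>.\<close>

definition tensor_elim ::
    "('k::field, 'u, 'n) module_scheme \<Rightarrow> ('a \<Rightarrow> 'b \<Rightarrow> 'u) \<Rightarrow> (('a \<times> 'b) \<Rightarrow>\<^sub>0 'k) set \<Rightarrow> 'u" where
  "tensor_elim U f = descend (linear_extension U (case_prod f))"

section \<open>Hopf algebras and pairs in involution\<close>

record (overloaded) ('k::zero, 'a) hopf = "('k, 'a) module" +
  comult :: "'a \<Rightarrow> (('a \<times> 'a) \<Rightarrow>\<^sub>0 'k) set"
  counit :: "'a \<Rightarrow> 'k"
  antipode :: "'a \<Rightarrow> 'a"

text \<open>
  Sweedler notation, for multilinear \<open>f\<close>: if \<open>\<Delta>(h)\<close> is the sum of the \<open>h\<^sub>1 \<otimes> h\<^sub>2\<close>, then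
  \<open>sweedler2 H U f h\<close> is the sum of the \<open>f h\<^sub>1 h\<^sub>2\<close>; likewise \<open>sweedler3\<close> for
  \<open>(\<Delta> \<otimes> id)(\<Delta>(h))\<close>.
\<close>

definition sweedler2 ::
    "('k::field, 'a, 'm) hopf_scheme \<Rightarrow> ('k, 'u, 'n) module_scheme \<Rightarrow> ('a \<Rightarrow> 'a \<Rightarrow> 'u) \<Rightarrow> 'a \<Rightarrow> 'u" where
  "sweedler2 H U f h = tensor_elim U f (comult H h)"

definition sweedler3 ::
    "('k::field, 'a, 'm) hopf_scheme \<Rightarrow> ('k, 'u, 'n) module_scheme
      \<Rightarrow> ('a \<Rightarrow> 'a \<Rightarrow> 'a \<Rightarrow> 'u) \<Rightarrow> 'a \<Rightarrow> 'u" where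
  "sweedler3 H U f = sweedler2 H U (\<lambda>a h\<^sub>3. sweedler2 H U (\<lambda>h\<^sub>1 h\<^sub>2. f h\<^sub>1 h\<^sub>2 h\<^sub>3) a)"

definition group_like :: "('k::field, 'a, 'm) hopf_scheme \<Rightarrow> 'a \<Rightarrow> bool" where
  "group_like H l \<longleftrightarrow>
     l \<in> carrier H \<and> comult H l = pure_tensor H H l l \<and> counit H l = 1"

text \<open>
  The group-like elements of the finite dual are the characters, and the inverse of the character
  \<open>\<beta>\<close> is \<open>\<beta> \<circ> S\<close>.
\<close>

definition pair_in_involution ::
    "('k::field, 'a, 'm) hopf_scheme \<Rightarrow> 'a \<Rightarrow> ('a \<Rightarrow> 'k) \<Rightarrow> bool" where
  "pair_in_involution H l \<beta> \<longleftrightarrow>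
     group_like H l \<and> \<beta> \<in> algebra_hom H field_algebra \<and>
     (\<forall>h \<in> carrier H. antipode H (antipode H h) =
        sweedler3 H H
          (\<lambda>h\<^sub>1 h\<^sub>2 h\<^sub>3. (\<beta> h\<^sub>3 * \<beta> (antipode H h\<^sub>1)) \<odot>\<^bsub>H\<^esub> (l \<otimes>\<^bsub>H\<^esub> h\<^sub>2 \<otimes>\<^bsub>H\<^esub> inv\<^bsub>H\<^esub> l)) h)"

section \<open>Generalised Taft algebras\<close>

datatype gen = Gen_g | Gen_x | Gen_y

definition free_algebra :: "('k::field, gen list \<Rightarrow>\<^sub>0 'k) module" where
  "free_algebra = monoid_algebra \<lparr>carrier = UNIV, monoid.mult = (@), one = []\<rparr>"

definition letter :: "gen \<Rightarrow> (gen list \<Rightarrow>\<^sub>0 'k::field)" where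
  "letter s = Poly_Mapping.single [s] 1"

text \<open>The algebra homomorphism out of the free algebra with prescribed values on the generators.\<close>

definition free_lift ::
    "('k::field, 'a, 'm) module_scheme \<Rightarrow> (gen \<Rightarrow> 'a) \<Rightarrow> (gen list \<Rightarrow>\<^sub>0 'k) \<Rightarrow> 'a" where
  "free_lift A v = linear_extension A (\<lambda>w. foldr (\<lambda>s a. v s \<otimes>\<^bsub>A\<^esub> a) w \<one>\<^bsub>A\<^esub>)"

definition primitive_root_of_unity :: "nat \<Rightarrow> 'k::field \<Rightarrow> bool" where
  "primitive_root_of_unity N q \<longleftrightarrow> 0 < N \<and> q ^ N = 1 \<and> (\<forall>m. 0 < m \<and> m < N \<longrightarrow> q ^ m \<noteq> 1)"

text \<open>
  Elements of \<open>\<int>\<^sub>N\<close> are represented by arbitrary integers.  This is harmless for the powers of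
  \<open>q\<close> and \<open>g\<close> below, since \<open>q\<close> and \<open>g\<close> have \<open>N\<close>-th power \<open>1\<close>.
\<close>

definition taft_parameters :: "nat \<Rightarrow> int \<Rightarrow> int \<Rightarrow> int \<Rightarrow> int \<Rightarrow> bool" where
  "taft_parameters N a11 a12 a21 a22 \<longleftrightarrow>
     N \<ge> 2 \<and> \<not> int N dvd a11 * a12 \<and> \<not> int N dvd a21 * a22 \<and>
     int N dvd a11 * a22 + a12 * a21"

definition additive_order :: "nat \<Rightarrow> int \<Rightarrow> nat" where
  "additive_order N a = group.ord (integer_mod_group N) (a mod int N)"

definition taft_relations ::
    "nat \<Rightarrow> 'k::field \<Rightarrow> int \<Rightarrow> int \<Rightarrow> int \<Rightarrow> int \<Rightarrow> (gen list \<Rightarrow>\<^sub>0 'k) set" where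
  "taft_relations N q a11 a12 a21 a22 =
     (let F = free_algebra; g = letter Gen_g; x = letter Gen_x; y = letter Gen_y in
       {x [^]\<^bsub>F\<^esub> additive_order N (a11 * a12),
        y [^]\<^bsub>F\<^esub> additive_order N (a21 * a22),
        x \<otimes>\<^bsub>F\<^esub> y \<ominus>\<^bsub>F\<^esub> (q powi (a11 * a22)) \<odot>\<^bsub>F\<^esub> (y \<otimes>\<^bsub>F\<^esub> x),
        g [^]\<^bsub>F\<^esub> N \<ominus>\<^bsub>F\<^esub> \<one>\<^bsub>F\<^esub>,
        g \<otimes>\<^bsub>F\<^esub> x \<ominus>\<^bsub>F\<^esub> (q powi a12) \<odot>\<^bsub>F\<^esub> (x \<otimes>\<^bsub>F\<^esub> g),
        g \<otimes>\<^bsub>F\<^esub> y \<ominus>\<^bsub>F\<^esub> (q powi a22) \<odot>\<^bsub>F\<^esub> (y \<otimes>\<^bsub>F\<^esub> g)})"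

definition taft_ideal ::
    "nat \<Rightarrow> 'k::field \<Rightarrow> int \<Rightarrow> int \<Rightarrow> int \<Rightarrow> int \<Rightarrow> (gen list \<Rightarrow>\<^sub>0 'k) set" where
  "taft_ideal N q a11 a12 a21 a22 = Idl\<^bsub>free_algebra\<^esub> (taft_relations N q a11 a12 a21 a22)"

definition taft_algebra ::
    "nat \<Rightarrow> 'k::field \<Rightarrow> int \<Rightarrow> int \<Rightarrow> int \<Rightarrow> int \<Rightarrow> ('k, (gen list \<Rightarrow>\<^sub>0 'k) set) module" where
  "taft_algebra N q a11 a12 a21 a22 =
     quotient_algebra free_algebra (taft_ideal N q a11 a12 a21 a22)"

text \<open>
  The coproduct and the counit are induced by algebra homomorphisms out of the free algebra, the
  antipode by an algebra homomorphism into the opposite algebra.  The counit is forced by the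
  coproduct.
\<close>

definition taft_hopf ::
    "nat \<Rightarrow> 'k::field \<Rightarrow> int \<Rightarrow> int \<Rightarrow> int \<Rightarrow> int \<Rightarrow> ('k, (gen list \<Rightarrow>\<^sub>0 'k) set) hopf" where
  "taft_hopf N q a11 a12 a21 a22 =
     (let A = taft_algebra N q a11 a12 a21 a22;
          cls = (\<lambda>s. taft_ideal N q a11 a12 a21 a22 +>\<^bsub>free_algebra\<^esub> letter s);
          g = cls Gen_g; x = cls Gen_x; y = cls Gen_y;
          T = tensor_algebra A A;
          tens = pure_tensor A A
      in module.extend A (hopf.fields
           (descend (free_lift T (case_gen
              (tens g g)
              (tens \<one>\<^bsub>A\<^esub> x \<oplus>\<^bsub>T\<^esub> tens x (g [^]\<^bsub>A\<^esub> a11))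
              (tens \<one>\<^bsub>A\<^esub> y \<oplus>\<^bsub>T\<^esub> tens y (g [^]\<^bsub>A\<^esub> a21)))))
           (descend (free_lift field_algebra (case_gen 1 0 0)))
           (descend (free_lift (opposite A) (case_gen
              (inv\<^bsub>A\<^esub> g)
              (\<ominus>\<^bsub>A\<^esub> (x \<otimes>\<^bsub>A\<^esub> g [^]\<^bsub>A\<^esub> (- a11)))
              (\<ominus>\<^bsub>A\<^esub> (y \<otimes>\<^bsub>A\<^esub> g [^]\<^bsub>A\<^esub> (- a21))))))))"

lemma taft_parameters_examples:
  "taft_parameters 48 34 26 4 4" "taft_parameters 48 34 26 28 4"
  by (simp_all add: taft_parameters_def)

end

theory Submission
  imports Defs
begin

text \<open>
  The entry \<open>a\<^sub>2\<^sub>1\<close> enters the defining relations of \<open>H\<^sub>q(a\<^sub>i\<^sub>j)\<close> only through the additive order of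
  \<open>a\<^sub>2\<^sub>1 a\<^sub>2\<^sub>2\<close>.  Modulo 48 both \<open>4 \<cdot> 4\<close> and \<open>28 \<cdot> 4\<close> are 16, so \<open>H\<close> and \<open>L\<close> have the same relations and
  are the same algebra (\<open>taft_algebra_cong\<close>).  They differ in the coproduct and the antipode of \<open>y\<close>, and
  whether a pair in involution exists depends on these.

  For a group-like \<open>l\<close> and a character \<open>\<beta>\<close>, both sides of the condition
  \<open>S\<^sup>2(h) = \<beta>(h\<^sub>3) \<beta>(S h\<^sub>1) l h\<^sub>2 l\<^sup>-\<^sup>1\<close> are algebra endomorphisms in \<open>h\<close>, so it suffices to compare them
  on \<open>g\<close>, \<open>x\<close>, \<open>y\<close> (\<open>pair_in_involution_iff\<close>).  There \<open>S\<^sup>2\<close> multiplies \<open>x\<close> by \<open>q\<close> to the power \<open>a\<^sub>1\<^sub>1 a\<^sub>1\<^sub>2\<close>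
  and \<open>y\<close> by \<open>q\<close> to the power \<open>a\<^sub>2\<^sub>1 a\<^sub>2\<^sub>2\<close>.  Since \<open>x\<close> and \<open>y\<close> are nilpotent, \<open>\<beta>\<close> vanishes on them, and only
  one term of the Sweedler sum survives: with \<open>\<zeta> = \<beta>(g)\<close> the right-hand side sends \<open>x\<close> to
  \<open>\<zeta>\<close> to the power \<open>a\<^sub>1\<^sub>1\<close> times \<open>l x l\<^sup>-\<^sup>1\<close>, and likewise for \<open>y\<close>.

  To extract a scalar equation from this for an arbitrary group-like \<open>l\<close>, let \<open>\<mu>\<close> be the value at \<open>l\<close> of the
  character \<open>g \<mapsto> q\<close>, \<open>x, y \<mapsto> 0\<close>.  A two-dimensional triangular representation in which \<open>x\<close> acts as a matrix
  unit shows that the equation on \<open>x\<close> forces \<open>\<zeta>\<close> to the power \<open>a\<^sub>1\<^sub>1\<close> times \<open>\<mu>\<close> to the power \<open>a\<^sub>1\<^sub>2\<close> to equal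
  \<open>q\<close> to the power \<open>a\<^sub>1\<^sub>1 a\<^sub>1\<^sub>2\<close> (\<open>group_like_eigenvalue\<close>, \<open>pair_in_involution_necessary\<close>).  Conversely every
  solution in exponents of \<open>q\<close> yields a pair with \<open>l\<close> a power of \<open>g\<close> (\<open>pair_in_involution_sufficient\<close>).  For
  \<open>L\<close> the values \<open>\<zeta> = q\<^sup>9\<close>, \<open>\<mu> = q\<^sup>1\<^sup>3\<close> work.  For \<open>H\<close> the cube of the equation for \<open>y\<close> says
  \<open>(\<zeta>\<mu>)\<^sup>1\<^sup>2 = 1\<close>, whereas the sixth power of the equation for \<open>x\<close> says \<open>(\<zeta>\<mu>)\<^sup>1\<^sup>2 = q\<^sup>2\<^sup>4\<close>.

  Two facts about the Hopf structure take work.  The coproduct respects \<open>x\<^sup>n = 0\<close> by the quantum binomial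
  formula at a root of unity (\<open>skew_nilpotent\<close>).  And \<open>l\<close> has to be invertible, which follows from the
  antipode axiom (\<open>antipode_left\<close>, \<open>antipode_right\<close>).
\<close>

section \<open>Algebras over a field and their linear maps\<close>

text \<open>
  Unital associative algebras over \<open>'k\<close>, not assumed commutative; every element of the type \<open>'k\<close> is a scalar.
\<close>

locale k_algebra = ring A for A :: "('k::field, 'a, 'm) module_scheme" (structure) +
  assumes smult_closed [simp, intro]: "a \<in> carrier A \<Longrightarrow> c \<odot> a \<in> carrier A"
    and smult_add_right: "a \<in> carrier A \<Longrightarrow> b \<in> carrier A \<Longrightarrow> c \<odot> (a \<oplus> b) = c \<odot> a \<oplus> c \<odot> b"
    and smult_add_left: "a \<in> carrier A \<Longrightarrow> (c + d) \<odot> a = c \<odot> a \<oplus> d \<odot> a"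
    and smult_smult: "a \<in> carrier A \<Longrightarrow> c \<odot> (d \<odot> a) = (c * d) \<odot> a"
    and smult_one [simp]: "a \<in> carrier A \<Longrightarrow> 1 \<odot> a = a"
    and smult_mult_left: "a \<in> carrier A \<Longrightarrow> b \<in> carrier A \<Longrightarrow> (c \<odot> a) \<otimes> b = c \<odot> (a \<otimes> b)"
    and smult_mult_right: "a \<in> carrier A \<Longrightarrow> b \<in> carrier A \<Longrightarrow> a \<otimes> (c \<odot> b) = c \<odot> (a \<otimes> b)"
begin

lemma smult_zero_left [simp]: "a \<in> carrier A \<Longrightarrow> 0 \<odot> a = \<zero>"
  using smult_add_left[of a 0 0] add.r_cancel_one' by (metis add_0 smult_closed)

lemma smult_zero_right [simp]: "c \<odot> \<zero> = \<zero>"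
  using smult_add_right[of \<zero> \<zero> c] add.r_cancel_one' by (metis l_zero smult_closed zero_closed)

lemma smult_minus_one: "a \<in> carrier A \<Longrightarrow> (- 1) \<odot> a = \<ominus> a"
  using smult_add_left[of a "- 1" 1] by (metis add.commute minus_equality neg_eq_iff_add_eq_0
    smult_closed smult_one smult_zero_left)

lemma smult_finsum:
  "finite S \<Longrightarrow> f \<in> S \<rightarrow> carrier A \<Longrightarrow> c \<odot> finsum A f S = finsum A (\<lambda>i. c \<odot> f i) S"
  by (induction S rule: finite_induct) (auto simp: smult_add_right Pi_iff)

end

definition linear_map ::
    "('k::field, 'a, 'm) module_scheme \<Rightarrow> ('k, 'b, 'n) module_scheme \<Rightarrow> ('a \<Rightarrow> 'b) set" where
  "linear_map A B = {f \<in> carrier A \<rightarrow> carrier B.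
     (\<forall>a\<in>carrier A. \<forall>b\<in>carrier A. f (a \<oplus>\<^bsub>A\<^esub> b) = f a \<oplus>\<^bsub>B\<^esub> f b) \<and>
     (\<forall>c. \<forall>a\<in>carrier A. f (c \<odot>\<^bsub>A\<^esub> a) = c \<odot>\<^bsub>B\<^esub> f a)}"

lemma linear_mapI:
  assumes "\<And>a. a \<in> carrier A \<Longrightarrow> f a \<in> carrier B"
    and "\<And>a b. a \<in> carrier A \<Longrightarrow> b \<in> carrier A \<Longrightarrow> f (a \<oplus>\<^bsub>A\<^esub> b) = f a \<oplus>\<^bsub>B\<^esub> f b"
    and "\<And>c a. a \<in> carrier A \<Longrightarrow> f (c \<odot>\<^bsub>A\<^esub> a) = c \<odot>\<^bsub>B\<^esub> f a"
  shows "f \<in> linear_map A B"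
  using assms by (simp add: linear_map_def)

lemma linear_mapD:
  assumes "f \<in> linear_map A B"
  shows linear_map_closed: "a \<in> carrier A \<Longrightarrow> f a \<in> carrier B"
    and linear_map_add:
      "a \<in> carrier A \<Longrightarrow> b \<in> carrier A \<Longrightarrow> f (a \<oplus>\<^bsub>A\<^esub> b) = f a \<oplus>\<^bsub>B\<^esub> f b"
    and linear_map_smult: "a \<in> carrier A \<Longrightarrow> f (c \<odot>\<^bsub>A\<^esub> a) = c \<odot>\<^bsub>B\<^esub> f a"
  using assms by (auto simp: linear_map_def)

lemma linear_map_comp:
  "f \<in> linear_map A B \<Longrightarrow> g \<in> linear_map B C \<Longrightarrow> (\<lambda>a. g (f a)) \<in> linear_map A C"
  by (auto simp: linear_map_def Pi_iff)

lemma linear_map_zero: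
  assumes "k_algebra A" "k_algebra B" "f \<in> linear_map A B"
  shows "f \<zero>\<^bsub>A\<^esub> = \<zero>\<^bsub>B\<^esub>"
proof -
  interpret A: k_algebra A by fact
  interpret B: k_algebra B by fact
  show ?thesis
    using linear_map_smult[OF assms(3) A.zero_closed, of 0] linear_map_closed[OF assms(3)] by simp
qed

lemma algebra_hom_linear_map: "\<phi> \<in> algebra_hom A B \<Longrightarrow> \<phi> \<in> linear_map A B"
  by (auto simp: algebra_hom_def linear_map_def ring_hom_def)

lemma algebra_homI:
  assumes "\<phi> \<in> linear_map A B"
    and "\<And>a b. a \<in> carrier A \<Longrightarrow> b \<in> carrier A \<Longrightarrow> \<phi> (a \<otimes>\<^bsub>A\<^esub> b) = \<phi> a \<otimes>\<^bsub>B\<^esub> \<phi> b"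
    and "\<phi> \<one>\<^bsub>A\<^esub> = \<one>\<^bsub>B\<^esub>"
  shows "\<phi> \<in> algebra_hom A B"
  using assms by (auto simp: algebra_hom_def linear_map_def ring_hom_def)

lemma algebra_homD:
  assumes "\<phi> \<in> algebra_hom A B"
  shows algebra_hom_closed: "a \<in> carrier A \<Longrightarrow> \<phi> a \<in> carrier B"
    and algebra_hom_add:
      "a \<in> carrier A \<Longrightarrow> b \<in> carrier A \<Longrightarrow> \<phi> (a \<oplus>\<^bsub>A\<^esub> b) = \<phi> a \<oplus>\<^bsub>B\<^esub> \<phi> b"
    and algebra_hom_smult: "a \<in> carrier A \<Longrightarrow> \<phi> (c \<odot>\<^bsub>A\<^esub> a) = c \<odot>\<^bsub>B\<^esub> \<phi> a"
    and algebra_hom_mult: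
      "a \<in> carrier A \<Longrightarrow> b \<in> carrier A \<Longrightarrow> \<phi> (a \<otimes>\<^bsub>A\<^esub> b) = \<phi> a \<otimes>\<^bsub>B\<^esub> \<phi> b"
    and algebra_hom_one: "\<phi> \<one>\<^bsub>A\<^esub> = \<one>\<^bsub>B\<^esub>"
  using assms by (auto simp: algebra_hom_def ring_hom_def)

lemma algebra_hom_comp:
  assumes "k_algebra A" "\<phi> \<in> algebra_hom A B" "\<psi> \<in> algebra_hom B C"
  shows "(\<lambda>a. \<psi> (\<phi> a)) \<in> algebra_hom A C"
  using assms by (auto simp: algebra_hom_def ring_hom_def Pi_iff)

lemma algebra_hom_pow:
  assumes "k_algebra A" "k_algebra B" "\<phi> \<in> algebra_hom A B" "a \<in> carrier A"
  shows "\<phi> (a [^]\<^bsub>A\<^esub> (n::nat)) = \<phi> a [^]\<^bsub>B\<^esub> n"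
proof -
  interpret A: k_algebra A by fact
  interpret B: k_algebra B by fact
  show ?thesis
    by (induction n) (use assms(4) in \<open>simp_all add: algebra_homD[OF assms(3)]\<close>)
qed

lemma algebra_hom_minus:
  assumes "k_algebra A" "k_algebra B" "\<phi> \<in> algebra_hom A B" "a \<in> carrier A" "b \<in> carrier A"
  shows "\<phi> (a \<ominus>\<^bsub>A\<^esub> b) = \<phi> a \<ominus>\<^bsub>B\<^esub> \<phi> b"
proof -
  interpret A: k_algebra A by fact
  interpret B: k_algebra B by fact
  show ?thesis
    using assms(4,5) by (simp add: a_minus_def algebra_homD[OF assms(3)]
      A.smult_minus_one[symmetric] B.smult_minus_one[symmetric] del: A.add.inv_closed)
qed

subsection \<open>The base field and the opposite algebra\<close>

lemma field_algebra_simps [simp]: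
  "carrier field_algebra = UNIV" "\<one>\<^bsub>field_algebra\<^esub> = 1" "\<zero>\<^bsub>field_algebra\<^esub> = 0"
  "a \<otimes>\<^bsub>field_algebra\<^esub> b = a * b" "a \<oplus>\<^bsub>field_algebra\<^esub> b = a + b"
  "a \<odot>\<^bsub>field_algebra\<^esub> b = a * b"
  by (simp_all add: field_algebra_def ring_of_type_algebra_def ring.defs module.defs)

lemma k_algebra_field: "k_algebra field_algebra"
proof (intro k_algebra.intro k_algebra_axioms.intro ringI abelian_groupI monoidI)
  fix x :: 'a
  show "\<exists>y\<in>carrier field_algebra. y \<oplus>\<^bsub>field_algebra\<^esub> x = \<zero>\<^bsub>field_algebra\<^esub>"
    by (rule bexI[of _ "- x"]) auto
qed (auto simp: algebra_simps)

lemma field_algebra_pow [simp]: "a [^]\<^bsub>field_algebra\<^esub> (n::nat) = a ^ n"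
  by (induction n) (simp_all add: nat_pow_def)

lemma opposite_simps [simp]:
  "carrier (opposite A) = carrier A" "\<one>\<^bsub>opposite A\<^esub> = \<one>\<^bsub>A\<^esub>" "\<zero>\<^bsub>opposite A\<^esub> = \<zero>\<^bsub>A\<^esub>"
  "a \<otimes>\<^bsub>opposite A\<^esub> b = b \<otimes>\<^bsub>A\<^esub> a" "a \<oplus>\<^bsub>opposite A\<^esub> b = a \<oplus>\<^bsub>A\<^esub> b"
  "c \<odot>\<^bsub>opposite A\<^esub> b = c \<odot>\<^bsub>A\<^esub> b"
  by (simp_all add: opposite_def)

context k_algebra
begin

lemma k_algebra_opposite: "k_algebra (opposite A)"
proof (intro k_algebra.intro k_algebra_axioms.intro ringI abelian_groupI monoidI)
  fix x assume "x \<in> carrier (opposite A)"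
  then show "\<exists>y\<in>carrier (opposite A). y \<oplus>\<^bsub>opposite A\<^esub> x = \<zero>\<^bsub>opposite A\<^esub>"
    by (intro bexI[of _ "\<ominus> x"]) (auto simp: l_neg)
qed (auto simp: m_assoc a_ac l_distr r_distr smult_add_left smult_add_right smult_smult
  smult_mult_left smult_mult_right)

lemma opposite_pow [simp]: "a \<in> carrier A \<Longrightarrow> a [^]\<^bsub>opposite A\<^esub> (n::nat) = a [^] n"
proof -
  interpret O: k_algebra "opposite A" by (rule k_algebra_opposite)
  assume a: "a \<in> carrier A"
  show ?thesis
  proof (induction n)
    case (Suc n)
    then show ?case
      using a by (simp only: nat_pow_Suc2 O.nat_pow_Suc opposite_simps)
  qed simp
qed

end

subsection \<open>Monoid algebras\<close>

lemma monoid_algebra_simps [simp]: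
  "carrier (monoid_algebra M) = {p. Poly_Mapping.keys p \<subseteq> carrier M}"
  "\<one>\<^bsub>monoid_algebra M\<^esub> = Poly_Mapping.single \<one>\<^bsub>M\<^esub> 1"
  "\<zero>\<^bsub>monoid_algebra M\<^esub> = 0"
  "p \<oplus>\<^bsub>monoid_algebra M\<^esub> r = p + r"
  "c \<odot>\<^bsub>monoid_algebra M\<^esub> p = Poly_Mapping.map ((*) c) p"
  by (simp_all add: monoid_algebra_def)

lemma lookup_map_times [simp]:
  "Poly_Mapping.lookup (Poly_Mapping.map ((*) c) p) w = c * Poly_Mapping.lookup p (w::'b)" for c :: "'a::field"
  by (simp add: Poly_Mapping.map.rep_eq when_def)

lemma keys_map_times: "Poly_Mapping.keys (Poly_Mapping.map ((*) c) p) \<subseteq> Poly_Mapping.keys p" for c :: "'a::field"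
  by (auto simp: in_keys_iff)

text \<open>
  The product of the monoid algebra is bilinear, so identities in it reduce by this rule to identities
  between multiples of single monoid elements.
\<close>

lemma poly_mapping_subset_induct [consumes 1, case_names zero single add]:
  assumes "Poly_Mapping.keys p \<subseteq> S"
    and "P 0"
    and "\<And>u c. u \<in> S \<Longrightarrow> P (Poly_Mapping.single u c)"
    and "\<And>p r. Poly_Mapping.keys p \<subseteq> S \<Longrightarrow> Poly_Mapping.keys r \<subseteq> S \<Longrightarrow> P p \<Longrightarrow> P r \<Longrightarrow> P (p + r)"
  shows "P (p :: 'm \<Rightarrow>\<^sub>0 'k::field)"
proof -
  have decomposition: "p = (\<Sum>u\<in>Poly_Mapping.keys p. Poly_Mapping.single u (Poly_Mapping.lookup p u))"
    by (rule poly_mapping_eqI)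
      (auto simp: lookup_sum lookup_single when_def in_keys_iff sum.delta)
  have "P (\<Sum>u\<in>T. Poly_Mapping.single u (Poly_Mapping.lookup p u)) \<and>
      Poly_Mapping.keys (\<Sum>u\<in>T. Poly_Mapping.single u (Poly_Mapping.lookup p u)) \<subseteq> S"
    if "finite T" "T \<subseteq> S" for T
    using that
  proof (induction T rule: finite_induct)
    case (insert u T)
    then show ?case
      using assms(4)[of "Poly_Mapping.single u (Poly_Mapping.lookup p u)"] assms(3)[of u]
        keys_add[of "Poly_Mapping.single u (Poly_Mapping.lookup p u)"
          "\<Sum>u\<in>T. Poly_Mapping.single u (Poly_Mapping.lookup p u)"]
      by (auto split: if_splits)
  qed (use assms(2) in auto)
  then show ?thesis
    using decomposition assms(1) by (metis finite_keys)
qed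

lemma monoid_algebra_mult_add_left:
  "(p + p') \<otimes>\<^bsub>monoid_algebra M\<^esub> r = p \<otimes>\<^bsub>monoid_algebra M\<^esub> r + p' \<otimes>\<^bsub>monoid_algebra M\<^esub> r"
  unfolding monoid_algebra_def monoid.simps
  by (rule setsum_keys_plus_distrib[where f = "\<lambda>u a. \<Sum>v\<in>Poly_Mapping.keys r.
        Poly_Mapping.single (u \<otimes>\<^bsub>M\<^esub> v) (a * Poly_Mapping.lookup r v)"])
     (simp_all add: distrib_right single_add sum.distrib)

lemma monoid_algebra_mult_add_right:
  "p \<otimes>\<^bsub>monoid_algebra M\<^esub> (r + r') = p \<otimes>\<^bsub>monoid_algebra M\<^esub> r + p \<otimes>\<^bsub>monoid_algebra M\<^esub> r'"
  unfolding monoid_algebra_def monoid.simps sum.distrib[symmetric]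
  by (rule sum.cong[OF refl], rule setsum_keys_plus_distrib)
     (simp_all add: distrib_left single_add)

lemma monoid_algebra_mult_zero [simp]:
  "0 \<otimes>\<^bsub>monoid_algebra M\<^esub> r = 0" "p \<otimes>\<^bsub>monoid_algebra M\<^esub> 0 = 0"
  by (simp_all add: monoid_algebra_def)

lemma monoid_algebra_mult_single:
  "Poly_Mapping.single u a \<otimes>\<^bsub>monoid_algebra M\<^esub> Poly_Mapping.single v b
    = Poly_Mapping.single (u \<otimes>\<^bsub>M\<^esub> v) (a * b)"
  by (auto simp: monoid_algebra_def)

lemma map_times_add:
  "Poly_Mapping.map ((*) c) (p + r) = Poly_Mapping.map ((*) c) p + Poly_Mapping.map ((*) c) r"
  for c :: "'a::field"
  by (rule poly_mapping_eqI) (simp add: lookup_add distrib_left)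

lemma map_times_single:
  "Poly_Mapping.map ((*) c) (Poly_Mapping.single u a) = Poly_Mapping.single u (c * a)"
  for c :: "'a::field"
  by (rule poly_mapping_eqI) (simp add: lookup_single when_def)

lemma map_times_zero [simp]: "Poly_Mapping.map ((*) c) 0 = 0" for c :: "'a::field"
  by (rule poly_mapping_eqI) simp

lemma monoid_algebra_smult_mult:
  "Poly_Mapping.map ((*) c) p \<otimes>\<^bsub>monoid_algebra M\<^esub> r
    = Poly_Mapping.map ((*) c) (p \<otimes>\<^bsub>monoid_algebra M\<^esub> r)" (is ?left)
  "p \<otimes>\<^bsub>monoid_algebra M\<^esub> Poly_Mapping.map ((*) c) r
    = Poly_Mapping.map ((*) c) (p \<otimes>\<^bsub>monoid_algebra M\<^esub> r)" (is ?right)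
proof -
  have "?left \<and> ?right" if "Poly_Mapping.keys p \<subseteq> UNIV"
    using that
  proof (induction p rule: poly_mapping_subset_induct)
    case (single u a)
    have "Poly_Mapping.keys r \<subseteq> UNIV" by simp
    then show ?case
      by (induction r rule: poly_mapping_subset_induct)
        (simp_all add: map_times_add map_times_single monoid_algebra_mult_add_right
          monoid_algebra_mult_single mult.assoc mult.left_commute)
  qed (simp_all add: map_times_add monoid_algebra_mult_add_left)
  then show ?left ?right by simp_all
qed

lemma k_algebra_monoid_algebra:
  assumes "monoid M"
  shows "k_algebra (monoid_algebra M :: ('k::field, 'm \<Rightarrow>\<^sub>0 'k) module)"
proof -
  interpret M: monoid M by fact
  let ?A = "monoid_algebra M :: ('k, 'm \<Rightarrow>\<^sub>0 'k) module"
  have closed: "p \<otimes>\<^bsub>?A\<^esub> r \<in> carrier ?A" if "p \<in> carrier ?A" "r \<in> carrier ?A" for p r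
  proof -
    have "Poly_Mapping.keys p \<subseteq> carrier M" using that by simp
    then show ?thesis
    proof (induction p rule: poly_mapping_subset_induct)
      case (single u a)
      have "Poly_Mapping.keys r \<subseteq> carrier M" using that by simp
      then show ?case
        by (induction r rule: poly_mapping_subset_induct)
          (use single in \<open>auto simp: monoid_algebra_mult_add_right monoid_algebra_mult_single
            dest!: subsetD[OF keys_add] split: if_splits\<close>)
    qed (auto simp: monoid_algebra_mult_add_left dest!: subsetD[OF keys_add])
  qed
  have assoc: "(p \<otimes>\<^bsub>?A\<^esub> r) \<otimes>\<^bsub>?A\<^esub> s = p \<otimes>\<^bsub>?A\<^esub> (r \<otimes>\<^bsub>?A\<^esub> s)"
    if "p \<in> carrier ?A" "r \<in> carrier ?A" "s \<in> carrier ?A" for p r s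
  proof -
    have "Poly_Mapping.keys p \<subseteq> carrier M" using that by simp
    then show ?thesis
    proof (induction p rule: poly_mapping_subset_induct)
      case (single u a)
      have "Poly_Mapping.keys r \<subseteq> carrier M" using that by simp
      then show ?case
      proof (induction r rule: poly_mapping_subset_induct)
        case r: (single v b)
        have "Poly_Mapping.keys s \<subseteq> carrier M" using that by simp
        then show ?case
          by (induction s rule: poly_mapping_subset_induct)
            (use single r in \<open>simp_all add: monoid_algebra_mult_add_right
              monoid_algebra_mult_single M.m_assoc mult_ac\<close>)
      qed (simp_all add: monoid_algebra_mult_add_right monoid_algebra_mult_add_left)
    qed (simp_all add: monoid_algebra_mult_add_left)
  qed
  have unit: "\<one>\<^bsub>?A\<^esub> \<otimes>\<^bsub>?A\<^esub> p = p \<and> p \<otimes>\<^bsub>?A\<^esub> \<one>\<^bsub>?A\<^esub> = p" if "p \<in> carrier ?A" for p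
  proof -
    have "Poly_Mapping.keys p \<subseteq> carrier M" using that by simp
    then show ?thesis
      by (induction p rule: poly_mapping_subset_induct)
        (simp_all add: monoid_algebra_mult_add_right monoid_algebra_mult_add_left
          monoid_algebra_mult_single)
  qed
  show ?thesis
  proof (intro k_algebra.intro k_algebra_axioms.intro ringI abelian_groupI monoidI)
    fix p assume "p \<in> carrier ?A"
    then show "\<exists>r\<in>carrier ?A. r \<oplus>\<^bsub>?A\<^esub> p = \<zero>\<^bsub>?A\<^esub>"
      by (intro bexI[of _ "- p"]) (auto simp: in_keys_iff subset_iff)
  next
    fix p c assume "p \<in> carrier ?A"
    then show "c \<odot>\<^bsub>?A\<^esub> p \<in> carrier ?A"
      using keys_map_times[of c p] by auto
  qed (use closed assoc unit in \<open>auto simp: monoid_algebra_mult_add_right monoid_algebra_mult_add_left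
      monoid_algebra_smult_mult add_ac map_times_add poly_mapping_eq_iff fun_eq_iff lookup_add
      algebra_simps dest!: subsetD[OF keys_add] split: if_splits\<close>)
qed

lemma linear_extension_single:
  assumes "k_algebra U" "f u \<in> carrier U"
  shows "linear_extension U f (Poly_Mapping.single u c) = c \<odot>\<^bsub>U\<^esub> f u"
proof -
  interpret U: k_algebra U by fact
  show ?thesis using assms(2) by (simp add: linear_extension_def Pi_iff)
qed

text \<open>
  The support of a sum can be smaller than the union of the supports.  All sums are therefore first
  extended to a common finite set, where the additional coefficients are zero.
\<close>

lemma linear_extension_linear_map:
  assumes "k_algebra U" "\<And>u. u \<in> carrier M \<Longrightarrow> f u \<in> carrier U"
  shows "linear_extension U f \<in> linear_map (monoid_algebra M) U"
proof (rule linear_mapI)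
  interpret U: k_algebra U by fact
  let ?t = "\<lambda>p w. Poly_Mapping.lookup p w \<odot>\<^bsub>U\<^esub> f w"
  have closed: "?t p \<in> Poly_Mapping.keys r \<rightarrow> carrier U" if "Poly_Mapping.keys r \<subseteq> carrier M" for p r
    using that assms(2) by auto
  have enlarge: "linear_extension U f p = finsum U (?t p) S"
    if "Poly_Mapping.keys p \<subseteq> S" "finite S" "S \<subseteq> carrier M" for p S
    unfolding linear_extension_def
    by (rule U.add.finprod_mono_neutral_cong_left)
      (use that assms(2) in \<open>auto simp: in_keys_iff\<close>)
  show "linear_extension U f p \<in> carrier U" if "p \<in> carrier (monoid_algebra M)" for p
    unfolding linear_extension_def using that closed by (intro U.finsum_closed) auto
  show "linear_extension U f (p \<oplus>\<^bsub>monoid_algebra M\<^esub> r)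
      = linear_extension U f p \<oplus>\<^bsub>U\<^esub> linear_extension U f r"
    if "p \<in> carrier (monoid_algebra M)" "r \<in> carrier (monoid_algebra M)" for p r
  proof -
    let ?S = "Poly_Mapping.keys p \<union> Poly_Mapping.keys r"
    have S: "finite ?S" "?S \<subseteq> carrier M" using that by auto
    have "linear_extension U f (p + r) = finsum U (?t (p + r)) ?S"
      using S keys_add[of p r] by (intro enlarge) auto
    also have "\<dots> = finsum U (\<lambda>w. ?t p w \<oplus>\<^bsub>U\<^esub> ?t r w) ?S"
      by (rule U.add.finprod_cong') (use S assms(2) in \<open>auto simp: lookup_add U.smult_add_left\<close>)
    also have "\<dots> = finsum U (?t p) ?S \<oplus>\<^bsub>U\<^esub> finsum U (?t r) ?S"
      by (rule U.add.finprod_multf) (use S assms(2) in auto)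
    also have "\<dots> = linear_extension U f p \<oplus>\<^bsub>U\<^esub> linear_extension U f r"
      using S enlarge[of p ?S] enlarge[of r ?S] by simp
    finally show ?thesis by simp
  qed
  show "linear_extension U f (c \<odot>\<^bsub>monoid_algebra M\<^esub> p) = c \<odot>\<^bsub>U\<^esub> linear_extension U f p"
    if "p \<in> carrier (monoid_algebra M)" for c p
  proof -
    let ?S = "Poly_Mapping.keys p"
    have "linear_extension U f (Poly_Mapping.map ((*) c) p)
        = finsum U (?t (Poly_Mapping.map ((*) c) p)) ?S"
      using that keys_map_times[of c p] by (intro enlarge) auto
    also have "\<dots> = finsum U (\<lambda>w. c \<odot>\<^bsub>U\<^esub> ?t p w) ?S"
      by (rule U.add.finprod_cong')
        (use that assms(2) in \<open>auto simp: U.smult_smult subset_iff\<close>)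
    also have "\<dots> = c \<odot>\<^bsub>U\<^esub> linear_extension U f p"
      unfolding linear_extension_def using that closed by (intro U.smult_finsum[symmetric]) auto
    finally show ?thesis by simp
  qed
qed

lemma linear_extension_algebra_hom:
  fixes U :: "('k::field, 'u, 'n) module_scheme" and M :: "('m, 'z) monoid_scheme"
  assumes "k_algebra U" "monoid M" "\<And>u. u \<in> carrier M \<Longrightarrow> f u \<in> carrier U"
    and "\<And>u v. u \<in> carrier M \<Longrightarrow> v \<in> carrier M \<Longrightarrow> f (u \<otimes>\<^bsub>M\<^esub> v) = f u \<otimes>\<^bsub>U\<^esub> f v"
    and "f \<one>\<^bsub>M\<^esub> = \<one>\<^bsub>U\<^esub>"
  shows "linear_extension U f \<in> algebra_hom (monoid_algebra M) U"
proof (rule algebra_homI)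
  interpret U: k_algebra U by fact
  interpret M: monoid M by fact
  interpret MA: k_algebra "monoid_algebra M :: ('k, 'm \<Rightarrow>\<^sub>0 'k) module"
    by (rule k_algebra_monoid_algebra) fact
  let ?F = "linear_extension U f"
  have lin: "?F \<in> linear_map (monoid_algebra M) U"
    using assms(1,3) by (rule linear_extension_linear_map)
  show "?F \<in> linear_map (monoid_algebra M) U" by fact
  show "?F \<one>\<^bsub>monoid_algebra M\<^esub> = \<one>\<^bsub>U\<^esub>"
    using assms(1,3,5) by (simp add: linear_extension_single)
  have add: "?F (p + r) = ?F p \<oplus>\<^bsub>U\<^esub> ?F r"
    if "Poly_Mapping.keys p \<subseteq> carrier M" "Poly_Mapping.keys r \<subseteq> carrier M" for p r
    using linear_map_add[OF lin, of p r] that by simp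
  have F0: "?F 0 = \<zero>\<^bsub>U\<^esub>"
    by (simp add: linear_extension_def)
  have closed: "?F p \<in> carrier U" if "Poly_Mapping.keys p \<subseteq> carrier M" for p
    using linear_map_closed[OF lin, of p] that by simp
  have mclosed: "Poly_Mapping.keys (p \<otimes>\<^bsub>monoid_algebra M\<^esub> r) \<subseteq> carrier M"
    if "Poly_Mapping.keys p \<subseteq> carrier M" "Poly_Mapping.keys r \<subseteq> carrier M" for p r :: "'m \<Rightarrow>\<^sub>0 'k"
    using MA.m_closed[of p r] that by simp
  show "?F (p \<otimes>\<^bsub>monoid_algebra M\<^esub> r) = ?F p \<otimes>\<^bsub>U\<^esub> ?F r"
    if "p \<in> carrier (monoid_algebra M)" "r \<in> carrier (monoid_algebra M)" for p r
  proof -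
    have p: "Poly_Mapping.keys p \<subseteq> carrier M" and r: "Poly_Mapping.keys r \<subseteq> carrier M"
      using that by auto
    from p show ?thesis
    proof (induction p rule: poly_mapping_subset_induct)
      case (single u a)
      then have ku: "Poly_Mapping.keys (Poly_Mapping.single u a) \<subseteq> carrier M" by simp
      from r show ?case
      proof (induction r rule: poly_mapping_subset_induct)
        case r: (single v b)
        then show ?case
          using single assms(3,4) by (simp add: monoid_algebra_mult_single
            linear_extension_single[OF assms(1)] U.smult_mult_left U.smult_mult_right U.smult_smult mult_ac)
      qed (use ku in \<open>simp_all add: monoid_algebra_mult_add_right add closed F0 mclosed U.r_distr\<close>)
    qed (use r in \<open>simp_all add: monoid_algebra_mult_add_left add closed F0 mclosed U.l_distr\<close>)
  qed
qed

subsection \<open>Quotients\<close>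

lemma quotient_algebra_simps [simp]:
  "carrier (quotient_algebra A I) = a_rcosets\<^bsub>A\<^esub> I"
  "\<one>\<^bsub>quotient_algebra A I\<^esub> = I +>\<^bsub>A\<^esub> \<one>\<^bsub>A\<^esub>"
  "\<zero>\<^bsub>quotient_algebra A I\<^esub> = I"
  by (simp_all add: quotient_algebra_def FactRing_def ring.defs module.defs)

locale algebra_ideal = k_algebra A + ideal I A for A (structure) and I
begin

abbreviation Q where "Q \<equiv> quotient_algebra A I"

lemma coset_closed: "a \<in> carrier A \<Longrightarrow> I +> a \<in> carrier Q"
  by (simp add: a_rcosetsI a_subset)

lemma coset_cases:
  assumes "C \<in> carrier Q" obtains a where "a \<in> carrier A" "C = I +> a"
  using assms by (auto simp: A_RCOSETS_def' )

lemma coset_add: "a \<in> carrier A \<Longrightarrow> b \<in> carrier A \<Longrightarrow> (I +> a) \<oplus>\<^bsub>Q\<^esub> (I +> b) = I +> (a \<oplus> b)"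
  by (simp add: quotient_algebra_def FactRing_def ring.defs module.defs a_rcos_sum)

lemma coset_mult: "a \<in> carrier A \<Longrightarrow> b \<in> carrier A \<Longrightarrow> (I +> a) \<otimes>\<^bsub>Q\<^esub> (I +> b) = I +> (a \<otimes> b)"
  by (simp add: quotient_algebra_def FactRing_def ring.defs module.defs rcoset_mult_add)

text \<open>
  The scalar \<open>c\<close> acts as multiplication by the ring element \<open>c \<odot> 1\<close>, so ideals are subspaces.
\<close>

lemma smult_ideal: "i \<in> I \<Longrightarrow> c \<odot> i \<in> I"
  using I_l_closed[of i "c \<odot> \<one>"] a_Hcarr[of i] by (simp add: smult_mult_left)

lemma coset_smult:
  assumes "a \<in> carrier A" shows "c \<odot>\<^bsub>Q\<^esub> (I +> a) = I +> (c \<odot> a)"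
proof -
  have "I +> (c \<odot> b) = I +> (c \<odot> a)" if "b \<in> I +> a" for b
  proof -
    have "\<exists>i\<in>I. b = i \<oplus> a"
      using that by (auto simp: a_r_coset_def')
    then obtain i where i: "i \<in> I" "b = i \<oplus> a" by blast
    have "c \<odot> b = c \<odot> i \<oplus> c \<odot> a"
      using i assms by (simp add: smult_add_right a_Hcarr)
    then have "c \<odot> b \<in> I +> (c \<odot> a)"
      using smult_ideal[OF i(1), of c] by (auto simp: a_r_coset_def')
    then show ?thesis
      using a_repr_independence' assms by blast
  qed
  moreover have "a \<in> I +> a"
    using assms by (rule a_rcos_self)
  ultimately have "(\<Union>b\<in>I +> a. I +> (c \<odot> b)) = I +> (c \<odot> a)"
    by blast
  then show ?thesis
    by (simp add: quotient_algebra_def FactRing_def ring.defs module.defs)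
qed

lemma k_algebra_quotient: "k_algebra Q"
proof -
  have zero: "\<zero>\<^bsub>Q\<^esub> = I +> \<zero>"
    using a_rcos_zero[OF ideal_axioms zero_closed] a_rcos_const[of \<zero>] by (simp add: zero_closed)
  have neg: "\<exists>D\<in>carrier Q. D \<oplus>\<^bsub>Q\<^esub> C = \<zero>\<^bsub>Q\<^esub>" if "C \<in> carrier Q" for C
  proof -
    obtain a where "a \<in> carrier A" "C = I +> a" using \<open>C \<in> carrier Q\<close> by (rule coset_cases)
    then show ?thesis
      by (intro bexI[of _ "I +> \<ominus> a"])
        (auto simp: zero coset_add coset_closed l_neg simp del: quotient_algebra_simps)
  qed
  have "ring Q"
    by (intro ringI abelian_groupI monoidI neg)
      (auto elim!: coset_cases simp: zero coset_add coset_mult coset_closed a_ac m_assoc l_distr r_distr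
        quotient_algebra_simps(2) simp del: quotient_algebra_simps(1,3))
  then show ?thesis
    by (intro k_algebra.intro k_algebra_axioms.intro)
      (auto elim!: coset_cases simp: coset_add coset_mult coset_smult coset_closed
        smult_add_left smult_add_right smult_smult smult_mult_left smult_mult_right
        simp del: quotient_algebra_simps)
qed

lemma coset_algebra_hom: "(+>) I \<in> algebra_hom A Q"
  by (intro algebra_homI linear_mapI)
    (auto simp: coset_add coset_mult coset_smult coset_closed simp del: quotient_algebra_simps(1))

lemma descend_coset:
  assumes "k_algebra U" "f \<in> linear_map A U" "\<And>i. i \<in> I \<Longrightarrow> f i = \<zero>\<^bsub>U\<^esub>" "a \<in> carrier A"
  shows "descend f (I +> a) = f a"
proof -
  interpret U: k_algebra U by fact
  have "f b = f a" if "b \<in> I +> a" for b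
    using that assms(3,4) by (auto simp: a_r_coset_def' linear_mapD[OF assms(2)] a_Hcarr)
  moreover have "a \<in> I +> a"
    using assms(4) by (rule a_rcos_self)
  ultimately have "f ` (I +> a) = {f a}" by blast
  then show ?thesis by (simp add: descend_def)
qed

lemma descend_linear_map:
  assumes "k_algebra U" "f \<in> linear_map A U" "\<And>i. i \<in> I \<Longrightarrow> f i = \<zero>\<^bsub>U\<^esub>"
  shows "descend f \<in> linear_map Q U"
  by (rule linear_mapI)
    (auto elim!: coset_cases simp: coset_add coset_smult descend_coset[OF assms] linear_mapD[OF assms(2)]
      simp del: quotient_algebra_simps)

lemma descend_algebra_hom:
  assumes "k_algebra U" "f \<in> algebra_hom A U" "\<And>i. i \<in> I \<Longrightarrow> f i = \<zero>\<^bsub>U\<^esub>"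
  shows "descend f \<in> algebra_hom Q U"
proof (rule algebra_homI)
  note lin = algebra_hom_linear_map[OF assms(2)]
  show "descend f \<in> linear_map Q U"
    using assms(1) lin assms(3) by (rule descend_linear_map)
qed (auto elim!: coset_cases simp: coset_mult descend_coset[OF assms(1) algebra_hom_linear_map[OF assms(2)] assms(3)]
    algebra_homD[OF assms(2)] simp del: quotient_algebra_simps(1,3))

end

section \<open>Tensor products\<close>

definition bilinear_map ::
    "('k::field, 'a, 'm) module_scheme \<Rightarrow> ('k, 'b, 'n) module_scheme \<Rightarrow> ('k, 'u, 'o) module_scheme
      \<Rightarrow> ('a \<Rightarrow> 'b \<Rightarrow> 'u) set" where
  "bilinear_map A B U = {f. (\<forall>b\<in>carrier B. (\<lambda>a. f a b) \<in> linear_map A U) \<and>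
     (\<forall>a\<in>carrier A. f a \<in> linear_map B U)}"

lemma bilinear_mapI:
  assumes "\<And>b. b \<in> carrier B \<Longrightarrow> (\<lambda>a. f a b) \<in> linear_map A U"
    and "\<And>a. a \<in> carrier A \<Longrightarrow> f a \<in> linear_map B U"
  shows "f \<in> bilinear_map A B U"
  using assms by (simp add: bilinear_map_def)

lemma bilinear_mapD:
  assumes "f \<in> bilinear_map A B U"
  shows bilinear_map_closed: "a \<in> carrier A \<Longrightarrow> b \<in> carrier B \<Longrightarrow> f a b \<in> carrier U"
    and bilinear_map_add_left: "a \<in> carrier A \<Longrightarrow> a' \<in> carrier A \<Longrightarrow> b \<in> carrier B
      \<Longrightarrow> f (a \<oplus>\<^bsub>A\<^esub> a') b = f a b \<oplus>\<^bsub>U\<^esub> f a' b"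
    and bilinear_map_add_right: "a \<in> carrier A \<Longrightarrow> b \<in> carrier B \<Longrightarrow> b' \<in> carrier B
      \<Longrightarrow> f a (b \<oplus>\<^bsub>B\<^esub> b') = f a b \<oplus>\<^bsub>U\<^esub> f a b'"
    and bilinear_map_smult_left: "a \<in> carrier A \<Longrightarrow> b \<in> carrier B
      \<Longrightarrow> f (c \<odot>\<^bsub>A\<^esub> a) b = c \<odot>\<^bsub>U\<^esub> f a b"
    and bilinear_map_smult_right: "a \<in> carrier A \<Longrightarrow> b \<in> carrier B
      \<Longrightarrow> f a (c \<odot>\<^bsub>B\<^esub> b) = c \<odot>\<^bsub>U\<^esub> f a b"
  using assms by (auto simp: bilinear_map_def linear_map_def Pi_iff)

lemma (in k_algebra) submodule_iff:
  "submodule W (ring_of_type_algebra :: 'k ring) A \<longleftrightarrow>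
     W \<subseteq> carrier A \<and> \<zero> \<in> W \<and> (\<forall>a\<in>W. \<forall>b\<in>W. a \<oplus> b \<in> W) \<and> (\<forall>c. \<forall>a\<in>W. c \<odot> a \<in> W)"
proof -
  have "inv\<^bsub>add_monoid A\<^esub> a \<in> W" if "\<forall>c. \<forall>a\<in>W. c \<odot> a \<in> W" "W \<subseteq> carrier A" "a \<in> W" for a
    using that smult_minus_one[of a] by (metis a_inv_def subsetD)
  then show ?thesis
    by (auto simp: submodule_def submodule_axioms_def subgroup_def ring_of_type_algebra_def)
qed

locale tensor_product = A: k_algebra A + B: k_algebra B
  for A :: "('k::field, 'a, 'm) module_scheme" and B :: "('k, 'b, 'n) module_scheme"
begin

abbreviation M :: "('k, ('a \<times> 'b) \<Rightarrow>\<^sub>0 'k) module" where "M \<equiv> monoid_algebra (A \<times>\<times> B)"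
abbreviation K where "K \<equiv> tensor_kernel A B"
abbreviation T where "T \<equiv> tensor_algebra A B"
abbreviation tens where "tens \<equiv> pure_tensor A B"

lemma monoid_pairs: "monoid (A \<times>\<times> B)"
  by (rule DirProd_monoid) unfold_locales

sublocale M: k_algebra M
  by (rule k_algebra_monoid_algebra) (rule monoid_pairs)

lemma single_carrier: "a \<in> carrier A \<Longrightarrow> b \<in> carrier B \<Longrightarrow> Poly_Mapping.single (a, b) c \<in> carrier M"
  by simp

lemma minus_carrier: "p \<in> carrier M \<Longrightarrow> r \<in> carrier M \<Longrightarrow> p - r \<in> carrier M"
  by (auto simp: in_keys_iff lookup_minus subset_iff)
    (metis (no_types, lifting) diff_0_eq_0 diff_self in_keys_iff)+

lemma relations_carrier: "bilinearity_relations A B \<subseteq> carrier M"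
  unfolding bilinearity_relations_def
  by (auto intro!: minus_carrier single_carrier simp del: monoid_algebra_simps)

lemma kernel_submodule: "submodule K (ring_of_type_algebra :: 'k ring) M"
  and kernel_relations: "bilinearity_relations A B \<subseteq> K"
proof -
  have "submodule (carrier M) (ring_of_type_algebra :: 'k ring) M"
    by (intro M.submodule_iff[THEN iffD2] conjI ballI allI) (auto simp del: monoid_algebra_simps)
  then have sub: "K \<subseteq> carrier M"
    unfolding tensor_kernel_def using relations_carrier by (intro hull_minimal)
  have "\<zero>\<^bsub>M\<^esub> \<in> K" "\<And>a b. a \<in> K \<Longrightarrow> b \<in> K \<Longrightarrow> a \<oplus>\<^bsub>M\<^esub> b \<in> K" "\<And>c a. a \<in> K \<Longrightarrow> c \<odot>\<^bsub>M\<^esub> a \<in> K"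
    unfolding tensor_kernel_def hull_def by (auto simp: M.submodule_iff simp del: monoid_algebra_simps)
  with sub show "submodule K (ring_of_type_algebra :: 'k ring) M"
    by (intro M.submodule_iff[THEN iffD2] conjI ballI allI)
  show "bilinearity_relations A B \<subseteq> K"
    unfolding tensor_kernel_def by (rule hull_subset)
qed

lemma kernel_least:
  assumes "submodule W (ring_of_type_algebra :: 'k ring) M" "bilinearity_relations A B \<subseteq> W"
  shows "K \<subseteq> W"
  unfolding tensor_kernel_def using assms by (intro hull_minimal)

lemma kernel_closed:
  "K \<subseteq> carrier M" "0 \<in> K" "p \<in> K \<Longrightarrow> r \<in> K \<Longrightarrow> p + r \<in> K"
  "p \<in> K \<Longrightarrow> Poly_Mapping.map ((*) c) p \<in> K"
  using kernel_submodule M.submodule_iff[of K] by auto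

lemma kernel_relation:
  "a \<in> carrier A \<Longrightarrow> a' \<in> carrier A \<Longrightarrow> b \<in> carrier B \<Longrightarrow>
    Poly_Mapping.single (a \<oplus>\<^bsub>A\<^esub> a', b) 1 - Poly_Mapping.single (a, b) 1 - Poly_Mapping.single (a', b) 1 \<in> K"
  "a \<in> carrier A \<Longrightarrow> b \<in> carrier B \<Longrightarrow> b' \<in> carrier B \<Longrightarrow>
    Poly_Mapping.single (a, b \<oplus>\<^bsub>B\<^esub> b') 1 - Poly_Mapping.single (a, b) 1 - Poly_Mapping.single (a, b') 1 \<in> K"
  "a \<in> carrier A \<Longrightarrow> b \<in> carrier B \<Longrightarrow>
    Poly_Mapping.single (c \<odot>\<^bsub>A\<^esub> a, b) 1 - Poly_Mapping.single (a, b) c \<in> K"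
  "a \<in> carrier A \<Longrightarrow> b \<in> carrier B \<Longrightarrow>
    Poly_Mapping.single (a, c \<odot>\<^bsub>B\<^esub> b) 1 - Poly_Mapping.single (a, b) c \<in> K"
  by (rule subsetD[OF kernel_relations], unfold bilinearity_relations_def, blast)+

lemma mult_minus:
  "(p - r) \<otimes>\<^bsub>M\<^esub> s = p \<otimes>\<^bsub>M\<^esub> s - r \<otimes>\<^bsub>M\<^esub> s" "s \<otimes>\<^bsub>M\<^esub> (p - r) = s \<otimes>\<^bsub>M\<^esub> p - s \<otimes>\<^bsub>M\<^esub> r"
  by (metis add_diff_cancel_right' diff_add_cancel monoid_algebra_mult_add_left,
      metis add_diff_cancel_right' diff_add_cancel monoid_algebra_mult_add_right)

text \<open>
  Multiplying a bilinearity relation by a pair gives another bilinearity relation, because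
  multiplication in each factor is linear.  Hence the linear span of the relations is an ideal.
\<close>

lemma relation_mult_single:
  assumes r: "r \<in> bilinearity_relations A B" and u: "u \<in> carrier (A \<times>\<times> B)"
  shows "Poly_Mapping.single u 1 \<otimes>\<^bsub>M\<^esub> r \<in> bilinearity_relations A B"
    and "r \<otimes>\<^bsub>M\<^esub> Poly_Mapping.single u 1 \<in> bilinearity_relations A B"
proof -
  obtain a b where u: "u = (a, b)" "a \<in> carrier A" "b \<in> carrier B"
    using u by auto
  note simps = mult_minus monoid_algebra_mult_single A.r_distr A.l_distr B.r_distr B.l_distr
    A.smult_mult_left A.smult_mult_right B.smult_mult_left B.smult_mult_right
  show "Poly_Mapping.single u 1 \<otimes>\<^bsub>M\<^esub> r \<in> bilinearity_relations A B"
    using r unfolding bilinearity_relations_def u(1)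
    by (elim UnE CollectE exE conjE; simp add: simps u(2,3)) (use u(2,3) in blast)+
  show "r \<otimes>\<^bsub>M\<^esub> Poly_Mapping.single u 1 \<in> bilinearity_relations A B"
    using r unfolding bilinearity_relations_def u(1)
    by (elim UnE CollectE exE conjE; simp add: simps u(2,3)) (use u(2,3) in blast)+
qed

lemma kernel_mult_single:
  assumes "u \<in> carrier (A \<times>\<times> B)" "w \<in> K"
  shows "Poly_Mapping.single u 1 \<otimes>\<^bsub>M\<^esub> w \<in> K \<and> w \<otimes>\<^bsub>M\<^esub> Poly_Mapping.single u 1 \<in> K"
proof -
  let ?W = "{w \<in> K. Poly_Mapping.single u 1 \<otimes>\<^bsub>M\<^esub> w \<in> K \<and> w \<otimes>\<^bsub>M\<^esub> Poly_Mapping.single u 1 \<in> K}"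
  have "K \<subseteq> ?W"
  proof (rule kernel_least)
    show "submodule ?W (ring_of_type_algebra :: 'k ring) M"
      unfolding M.submodule_iff using kernel_closed
      by (auto simp: monoid_algebra_mult_add_left monoid_algebra_mult_add_right monoid_algebra_smult_mult)
    show "bilinearity_relations A B \<subseteq> ?W"
      using kernel_relations relation_mult_single assms(1) by auto
  qed
  then show ?thesis using assms(2) by auto
qed

lemma kernel_mult:
  assumes "s \<in> carrier M" "w \<in> K"
  shows "s \<otimes>\<^bsub>M\<^esub> w \<in> K \<and> w \<otimes>\<^bsub>M\<^esub> s \<in> K"
proof -
  have "Poly_Mapping.keys s \<subseteq> carrier (A \<times>\<times> B)" using assms(1) by simp
  then show ?thesis
  proof (induction s rule: poly_mapping_subset_induct)
    case (single u c)
    have "Poly_Mapping.single u c = Poly_Mapping.map ((*) c) (Poly_Mapping.single u 1)"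
      by (simp add: map_times_single)
    show ?case
      unfolding \<open>Poly_Mapping.single u c = _\<close> monoid_algebra_smult_mult
      using kernel_mult_single[OF single assms(2)] kernel_closed(4) by blast
  qed (use kernel_closed in \<open>auto simp: monoid_algebra_mult_add_left monoid_algebra_mult_add_right\<close>)
qed

lemma kernel_ideal: "ideal K M"
proof (rule idealI)
  show "ring M" by unfold_locales
  show "subgroup K (add_monoid M)" using kernel_submodule by (simp add: submodule_def)
qed (use kernel_mult in auto)

sublocale K: algebra_ideal M K
  by (intro algebra_ideal.intro kernel_ideal M.k_algebra_axioms)

lemma T_eq: "T = K.Q"
  by (simp add: tensor_algebra_def)

sublocale T: k_algebra T
  unfolding T_eq by (rule K.k_algebra_quotient)

lemma pure_eq: "tens a b = K +>\<^bsub>M\<^esub> Poly_Mapping.single (a, b) 1"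
  by (simp add: pure_tensor_def)

lemma pure_closed [simp, intro]: "a \<in> carrier A \<Longrightarrow> b \<in> carrier B \<Longrightarrow> tens a b \<in> carrier T"
  unfolding pure_eq T_eq by (intro K.coset_closed single_carrier)

lemma pure_mult:
  "a \<in> carrier A \<Longrightarrow> b \<in> carrier B \<Longrightarrow> a' \<in> carrier A \<Longrightarrow> b' \<in> carrier B \<Longrightarrow>
    tens a b \<otimes>\<^bsub>T\<^esub> tens a' b' = tens (a \<otimes>\<^bsub>A\<^esub> a') (b \<otimes>\<^bsub>B\<^esub> b')"
  unfolding pure_eq T_eq
  by (simp add: K.coset_mult[OF single_carrier single_carrier] monoid_algebra_mult_single)

lemma pure_one: "\<one>\<^bsub>T\<^esub> = tens \<one>\<^bsub>A\<^esub> \<one>\<^bsub>B\<^esub>"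
  unfolding pure_eq T_eq by simp

lemma coset_eqI:
  assumes "p \<in> carrier M" "r \<in> carrier M" "p - r \<in> K"
  shows "K +>\<^bsub>M\<^esub> p = K +>\<^bsub>M\<^esub> r"
proof -
  have "p = (p - r) \<oplus>\<^bsub>M\<^esub> r" by simp
  then have "p \<in> K +>\<^bsub>M\<^esub> r" using assms(3) unfolding a_r_coset_def' by blast
  then show ?thesis using K.a_repr_independence'[OF _ assms(2)] by metis
qed

lemma pure_add_left:
  assumes "a \<in> carrier A" "a' \<in> carrier A" "b \<in> carrier B"
  shows "tens (a \<oplus>\<^bsub>A\<^esub> a') b = tens a b \<oplus>\<^bsub>T\<^esub> tens a' b"
  unfolding pure_eq T_eq K.coset_add[OF single_carrier[OF assms(1,3)] single_carrier[OF assms(2,3)]]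
proof (rule coset_eqI)
  show "Poly_Mapping.single (a \<oplus>\<^bsub>A\<^esub> a', b) 1
      - (Poly_Mapping.single (a, b) 1 \<oplus>\<^bsub>M\<^esub> Poly_Mapping.single (a', b) 1) \<in> K"
    using kernel_relation(1)[OF assms] by (simp add: diff_diff_eq)
qed (use assms in \<open>auto intro!: M.a_closed single_carrier simp del: monoid_algebra_simps\<close>)

lemma pure_add_right:
  assumes "a \<in> carrier A" "b \<in> carrier B" "b' \<in> carrier B"
  shows "tens a (b \<oplus>\<^bsub>B\<^esub> b') = tens a b \<oplus>\<^bsub>T\<^esub> tens a b'"
  unfolding pure_eq T_eq K.coset_add[OF single_carrier[OF assms(1,2)] single_carrier[OF assms(1,3)]]
proof (rule coset_eqI)
  show "Poly_Mapping.single (a, b \<oplus>\<^bsub>B\<^esub> b') 1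
      - (Poly_Mapping.single (a, b) 1 \<oplus>\<^bsub>M\<^esub> Poly_Mapping.single (a, b') 1) \<in> K"
    using kernel_relation(2)[OF assms] by (simp add: diff_diff_eq)
qed (use assms in \<open>auto intro!: M.a_closed single_carrier simp del: monoid_algebra_simps\<close>)

lemma smult_pure:
  assumes "a \<in> carrier A" "b \<in> carrier B"
  shows "c \<odot>\<^bsub>T\<^esub> tens a b = K +>\<^bsub>M\<^esub> Poly_Mapping.single (a, b) c"
  unfolding pure_eq T_eq K.coset_smult[OF single_carrier[OF assms]]
  by (simp add: map_times_single)

lemma pure_smult_left:
  assumes "a \<in> carrier A" "b \<in> carrier B"
  shows "tens (c \<odot>\<^bsub>A\<^esub> a) b = c \<odot>\<^bsub>T\<^esub> tens a b"
  unfolding smult_pure[OF assms] unfolding pure_eq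
  using assms by (intro coset_eqI single_carrier kernel_relation) auto

lemma pure_smult_right:
  assumes "a \<in> carrier A" "b \<in> carrier B"
  shows "tens a (c \<odot>\<^bsub>B\<^esub> b) = c \<odot>\<^bsub>T\<^esub> tens a b"
  unfolding smult_pure[OF assms] unfolding pure_eq
  using assms by (intro coset_eqI single_carrier kernel_relation) auto

lemma pure_zero: "a \<in> carrier A \<Longrightarrow> tens a \<zero>\<^bsub>B\<^esub> = \<zero>\<^bsub>T\<^esub>" "b \<in> carrier B \<Longrightarrow> tens \<zero>\<^bsub>A\<^esub> b = \<zero>\<^bsub>T\<^esub>"
  using pure_smult_right[of a "\<zero>\<^bsub>B\<^esub>" 0] pure_smult_left[of "\<zero>\<^bsub>A\<^esub>" b 0] by auto

lemma pure_pow: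
  assumes "a \<in> carrier A" "b \<in> carrier B"
  shows "tens a b [^]\<^bsub>T\<^esub> (n::nat) = tens (a [^]\<^bsub>A\<^esub> n) (b [^]\<^bsub>B\<^esub> n)"
  by (induction n) (use assms in \<open>simp_all add: pure_one pure_mult\<close>)

text \<open>
  The linear span of the pure tensors is everything, so a linear statement is verified on pure tensors.
\<close>

lemma tensor_induct [consumes 1, case_names pure add smult]:
  assumes "t \<in> carrier T"
    and pure: "\<And>a b. a \<in> carrier A \<Longrightarrow> b \<in> carrier B \<Longrightarrow> P (tens a b)"
    and add: "\<And>s t. s \<in> carrier T \<Longrightarrow> t \<in> carrier T \<Longrightarrow> P s \<Longrightarrow> P t \<Longrightarrow> P (s \<oplus>\<^bsub>T\<^esub> t)"
    and smult: "\<And>c t. t \<in> carrier T \<Longrightarrow> P t \<Longrightarrow> P (c \<odot>\<^bsub>T\<^esub> t)"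
  shows "P t"
proof -
  obtain p where p: "p \<in> carrier M" "t = K +>\<^bsub>M\<^esub> p"
    using assms(1) unfolding T_eq by (rule K.coset_cases)
  have "Poly_Mapping.keys p \<subseteq> carrier (A \<times>\<times> B)" using p(1) by simp
  then have "P (K +>\<^bsub>M\<^esub> p)"
  proof (induction p rule: poly_mapping_subset_induct)
    case zero
    have "Poly_Mapping.single (\<one>\<^bsub>A\<^esub>, \<one>\<^bsub>B\<^esub>) 0 = (0 :: _ \<Rightarrow>\<^sub>0 'k)" by simp
    then show ?case
      using smult[OF pure_closed pure, of "\<one>\<^bsub>A\<^esub>" "\<one>\<^bsub>B\<^esub>" 0] smult_pure[of "\<one>\<^bsub>A\<^esub>" "\<one>\<^bsub>B\<^esub>" 0] by simp
  next
    case (single u c)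
    then show ?case
      using smult[OF pure_closed pure, of "fst u" "snd u" c] smult_pure[of "fst u" "snd u" c] by auto
  next
    case (add p r)
    then have "p \<in> carrier M" "r \<in> carrier M" by auto
    then show ?case
      using assms(3)[of "K +>\<^bsub>M\<^esub> p" "K +>\<^bsub>M\<^esub> r"] add K.coset_closed K.coset_add[of p r]
      unfolding T_eq by simp
  qed
  then show ?thesis using p(2) by simp
qed

lemma tensor_elim:
  assumes "k_algebra U" "f \<in> bilinear_map A B U"
  shows tensor_elim_linear_map: "tensor_elim U f \<in> linear_map T U"
    and tensor_elim_pure: "\<And>a b. a \<in> carrier A \<Longrightarrow> b \<in> carrier B \<Longrightarrow> tensor_elim U f (tens a b) = f a b"
proof -
  interpret U: k_algebra U by fact
  let ?F = "linear_extension U (case_prod f)"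
  have closed: "case_prod f u \<in> carrier U" if "u \<in> carrier (A \<times>\<times> B)" for u
    using that bilinear_map_closed[OF assms(2)] by auto
  have lin: "?F \<in> linear_map M U"
    using assms(1) closed by (rule linear_extension_linear_map)
  have single: "?F (Poly_Mapping.single (a, b) c) = c \<odot>\<^bsub>U\<^esub> f a b"
    if "a \<in> carrier A" "b \<in> carrier B" for a b c
    using linear_extension_single[OF assms(1), of "case_prod f" "(a, b)"] closed[of "(a, b)"] that by simp
  have diff: "?F (p - r) = ?F p \<ominus>\<^bsub>U\<^esub> ?F r" if "p \<in> carrier M" "r \<in> carrier M" for p r
  proof -
    have "?F p = ?F (p - r) \<oplus>\<^bsub>U\<^esub> ?F r"
      using linear_map_add[OF lin minus_carrier[OF that] that(2)] by simp
    then show ?thesis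
      using linear_map_closed[OF lin] minus_carrier[OF that] that(2)
      by (simp add: U.minus_eq U.a_assoc U.r_neg del: monoid_algebra_simps)
  qed
  let ?W = "{w \<in> carrier M. ?F w = \<zero>\<^bsub>U\<^esub>}"
  have "K \<subseteq> ?W"
  proof (rule kernel_least)
    show "submodule ?W (ring_of_type_algebra :: 'k ring) M"
      unfolding M.submodule_iff
      by (auto simp: linear_map_add[OF lin] linear_map_smult[OF lin]
          linear_map_zero[OF M.k_algebra_axioms assms(1) lin] simp del: monoid_algebra_simps)
      have cancel: "u \<oplus>\<^bsub>U\<^esub> v \<ominus>\<^bsub>U\<^esub> u \<ominus>\<^bsub>U\<^esub> v = \<zero>\<^bsub>U\<^esub>"
      if "u \<in> carrier U" "v \<in> carrier U" for u v
      using that by algebra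
    have "?F r = \<zero>\<^bsub>U\<^esub>" if "r \<in> bilinearity_relations A B" for r
      using that unfolding bilinearity_relations_def
      by (elim UnE CollectE exE conjE)
        (simp_all add: diff single_carrier minus_carrier single bilinear_mapD[OF assms(2)]
          cancel U.minus_eq[of u u for u] U.r_neg del: monoid_algebra_simps)
    then show "bilinearity_relations A B \<subseteq> ?W"
      using relations_carrier by blast
  qed
  then have kills: "?F w = \<zero>\<^bsub>U\<^esub>" if "w \<in> K" for w using that by blast
  show "tensor_elim U f \<in> linear_map T U"
    unfolding T_eq tensor_elim_def using assms(1) lin kills by (rule K.descend_linear_map)
  show "tensor_elim U f (tens a b) = f a b" if "a \<in> carrier A" "b \<in> carrier B" for a b
    unfolding tensor_elim_def pure_eq
    using K.descend_coset[OF assms(1) lin kills single_carrier[OF that]] single[OF that, of 1]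
      bilinear_map_closed[OF assms(2) that] by simp
qed

lemma tensor_elim_algebra_hom:
  assumes "k_algebra U" "f \<in> bilinear_map A B U"
    and mult: "\<And>a a' b b'. a \<in> carrier A \<Longrightarrow> a' \<in> carrier A \<Longrightarrow> b \<in> carrier B \<Longrightarrow> b' \<in> carrier B
      \<Longrightarrow> f (a \<otimes>\<^bsub>A\<^esub> a') (b \<otimes>\<^bsub>B\<^esub> b') = f a b \<otimes>\<^bsub>U\<^esub> f a' b'"
    and one: "f \<one>\<^bsub>A\<^esub> \<one>\<^bsub>B\<^esub> = \<one>\<^bsub>U\<^esub>"
  shows "tensor_elim U f \<in> algebra_hom T U"
proof (rule algebra_homI)
  interpret U: k_algebra U by fact
  note lin = tensor_elim_linear_map[OF assms(1,2)] and el = tensor_elim_pure[OF assms(1,2)]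
  show "tensor_elim U f \<in> linear_map T U" by fact
  show "tensor_elim U f \<one>\<^bsub>T\<^esub> = \<one>\<^bsub>U\<^esub>" by (simp add: pure_one el one)
  fix s t assume "s \<in> carrier T" "t \<in> carrier T"
  then show "tensor_elim U f (s \<otimes>\<^bsub>T\<^esub> t) = tensor_elim U f s \<otimes>\<^bsub>U\<^esub> tensor_elim U f t"
  proof (induction s rule: tensor_induct)
    case (pure a b)
    from pure(3,1,2) show ?case
    proof (induction t rule: tensor_induct)
      case (pure a' b')
      then show ?case by (simp add: pure_mult el mult)
    qed (simp_all add: T.r_distr T.smult_mult_right linear_mapD[OF lin] U.r_distr U.smult_mult_right)
  qed (simp_all add: T.l_distr T.smult_mult_left linear_mapD[OF lin] U.l_distr U.smult_mult_left)
qed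

text \<open>
  The maps need only be related on the carriers.  Besides congruence this pulls the scalar
  \<open>c\<close> out of a Sweedler sum in which further arguments are held fixed.
\<close>

lemma tensor_elim_scaled_cong:
  assumes "k_algebra U" "f \<in> bilinear_map A B U" "t \<in> carrier T"
    and eq: "\<And>a b. a \<in> carrier A \<Longrightarrow> b \<in> carrier B \<Longrightarrow> f' a b = c \<odot>\<^bsub>U\<^esub> f a b"
  shows "tensor_elim U f' t = c \<odot>\<^bsub>U\<^esub> tensor_elim U f t"
proof -
  interpret U: k_algebra U by fact
  have f': "f' \<in> bilinear_map A B U"
    by (intro bilinear_mapI linear_mapI)
      (simp_all add: eq bilinear_mapD[OF assms(2)] U.smult_add_right U.smult_smult mult.commute)
  note lin = tensor_elim_linear_map[OF assms(1,2)] tensor_elim_linear_map[OF assms(1) f']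
  show ?thesis
    using assms(3)
  proof (induction t rule: tensor_induct)
    case (pure a b)
    then show ?case
      by (simp add: tensor_elim_pure[OF assms(1,2)] tensor_elim_pure[OF assms(1) f'] eq)
  qed (simp_all add: linear_mapD[OF lin(1)] linear_mapD[OF lin(2)] U.smult_add_right U.smult_smult
      mult.commute)
qed

end

section \<open>The free algebra on three generators\<close>

abbreviation (input) words :: "gen list monoid" where
  "words \<equiv> \<lparr>carrier = UNIV, monoid.mult = (@), one = []\<rparr>"

lemma monoid_words: "monoid words"
  by (rule monoidI) auto

lemma k_algebra_free: "k_algebra free_algebra"
  unfolding free_algebra_def by (rule k_algebra_monoid_algebra) (rule monoid_words)

lemma free_algebra_carrier [simp]: "carrier free_algebra = UNIV"
  by (simp add: free_algebra_def)

context k_algebra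
begin

lemma word_value_closed [simp]:
  "(\<And>s. v s \<in> carrier A) \<Longrightarrow> foldr (\<lambda>s a. v s \<otimes> a) w \<one> \<in> carrier A"
  by (induction w) auto

lemma word_value_append:
  "(\<And>s. v s \<in> carrier A) \<Longrightarrow> foldr (\<lambda>s a. v s \<otimes> a) (u @ w) \<one>
     = foldr (\<lambda>s a. v s \<otimes> a) u \<one> \<otimes> foldr (\<lambda>s a. v s \<otimes> a) w \<one>"
  by (induction u) (simp_all add: m_assoc)

lemma free_lift_algebra_hom:
  assumes "\<And>s. v s \<in> carrier A"
  shows "free_lift A v \<in> algebra_hom free_algebra A"
  unfolding free_lift_def free_algebra_def
  by (rule linear_extension_algebra_hom)
    (use assms in \<open>simp_all add: k_algebra_axioms monoid_words word_value_append del: foldr_append\<close>)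

lemma free_lift_letter:
  assumes "\<And>s. v s \<in> carrier A"
  shows "free_lift A v (letter s) = v s"
  unfolding free_lift_def letter_def
  using assms by (subst linear_extension_single) (auto simp: k_algebra_axioms)

lemma algebra_hom_genideal:
  assumes "k_algebra B" "\<phi> \<in> algebra_hom A B" "S \<subseteq> carrier A" "\<And>s. s \<in> S \<Longrightarrow> \<phi> s = \<zero>\<^bsub>B\<^esub>"
    and "i \<in> Idl S"
  shows "\<phi> i = \<zero>\<^bsub>B\<^esub>"
proof -
  interpret B: k_algebra B by fact
  have "\<phi> \<in> ring_hom A B"
    using assms(2) by (simp add: algebra_hom_def)
  then interpret \<phi>: ring_hom_ring A B \<phi>
    by (intro ring_hom_ringI2 ring_axioms B.ring_axioms)
  have kernel: "a_kernel A B \<phi> = {a \<in> carrier A. \<phi> a = \<zero>\<^bsub>B\<^esub>}"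
    by (rule a_kernel_def')
  have "S \<subseteq> a_kernel A B \<phi>"
    unfolding kernel using assms(3,4) by blast
  then have "Idl S \<subseteq> a_kernel A B \<phi>"
    by (rule genideal_minimal[OF \<phi>.kernel_is_ideal])
  then show ?thesis using assms(5) unfolding kernel by blast
qed

end

section \<open>Commutation up to a scalar\<close>

definition q_commute :: "('k::field, 'a, 'm) module_scheme \<Rightarrow> 'k \<Rightarrow> 'a \<Rightarrow> 'a \<Rightarrow> bool" where
  "q_commute A c a b \<longleftrightarrow> a \<otimes>\<^bsub>A\<^esub> b = c \<odot>\<^bsub>A\<^esub> (b \<otimes>\<^bsub>A\<^esub> a)"

context k_algebra
begin

lemma q_commute_one_right: "a \<in> carrier A \<Longrightarrow> q_commute A 1 a \<one>"
  by (simp add: q_commute_def)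

lemma q_commute_one_left: "a \<in> carrier A \<Longrightarrow> q_commute A 1 \<one> a"
  by (simp add: q_commute_def)

lemma q_commute_refl: "a \<in> carrier A \<Longrightarrow> q_commute A 1 a a"
  by (simp add: q_commute_def)

lemma q_commute_sym:
  assumes "q_commute A c a b" "c \<noteq> 0" "a \<in> carrier A" "b \<in> carrier A"
  shows "q_commute A (inverse c) b a"
  using assms by (simp add: q_commute_def smult_smult)

lemma q_commute_mult_left:
  assumes "q_commute A c a b" "q_commute A d a' b" "a \<in> carrier A" "a' \<in> carrier A" "b \<in> carrier A"
  shows "q_commute A (c * d) (a \<otimes> a') b"
proof -
  have "(a \<otimes> a') \<otimes> b = a \<otimes> (d \<odot> (b \<otimes> a'))"
    using assms by (simp add: q_commute_def m_assoc)
  also have "\<dots> = d \<odot> ((a \<otimes> b) \<otimes> a')"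
    using assms(3-5) by (simp add: smult_mult_right m_assoc)
  also have "\<dots> = (c * d) \<odot> (b \<otimes> (a \<otimes> a'))"
    using assms by (simp add: q_commute_def m_assoc smult_mult_left smult_smult mult.commute)
  finally show ?thesis by (simp add: q_commute_def)
qed

lemma q_commute_mult_right:
  assumes "q_commute A c a b" "q_commute A d a b'" "a \<in> carrier A" "b \<in> carrier A" "b' \<in> carrier A"
  shows "q_commute A (c * d) a (b \<otimes> b')"
proof -
  have "a \<otimes> (b \<otimes> b') = (a \<otimes> b) \<otimes> b'"
    using assms(3-5) by (simp add: m_assoc)
  also have "\<dots> = c \<odot> (b \<otimes> (a \<otimes> b'))"
    using assms by (simp add: q_commute_def smult_mult_left m_assoc)
  also have "\<dots> = (c * d) \<odot> ((b \<otimes> b') \<otimes> a)"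
    using assms by (simp add: q_commute_def m_assoc smult_mult_right smult_smult)
  finally show ?thesis by (simp add: q_commute_def)
qed

lemma q_commute_add_left:
  assumes "q_commute A c a b" "q_commute A c a' b" "a \<in> carrier A" "a' \<in> carrier A" "b \<in> carrier A"
  shows "q_commute A c (a \<oplus> a') b"
  using assms by (simp add: q_commute_def l_distr r_distr smult_add_right)

lemma q_commute_add_right:
  assumes "q_commute A c a b" "q_commute A c a b'" "a \<in> carrier A" "b \<in> carrier A" "b' \<in> carrier A"
  shows "q_commute A c a (b \<oplus> b')"
  using assms by (simp add: q_commute_def l_distr r_distr smult_add_right)

lemma q_commute_minus_left:
  assumes "q_commute A c a b" "a \<in> carrier A" "b \<in> carrier A"
  shows "q_commute A c (\<ominus> a) b"
  using assms by (simp add: q_commute_def smult_minus_one[symmetric] smult_mult_left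
      smult_mult_right smult_smult mult.commute)

lemma q_commute_minus_right:
  assumes "q_commute A c a b" "a \<in> carrier A" "b \<in> carrier A"
  shows "q_commute A c a (\<ominus> b)"
  using assms by (simp add: q_commute_def smult_minus_one[symmetric] smult_mult_left
      smult_mult_right smult_smult mult.commute)

lemma q_commute_pow_left:
  assumes "q_commute A c a b" "a \<in> carrier A" "b \<in> carrier A"
  shows "q_commute A (c ^ n) (a [^] (n::nat)) b"
proof (induction n)
  case (Suc n)
  then show ?case
    using q_commute_mult_left[of "c ^ n" "a [^] n" b c a] assms by (simp add: mult.commute)
qed (use assms in \<open>simp add: q_commute_one_left\<close>)

lemma q_commute_pow_right:
  assumes "q_commute A c a b" "a \<in> carrier A" "b \<in> carrier A"
  shows "q_commute A (c ^ n) a (b [^] (n::nat))"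
proof (induction n)
  case (Suc n)
  then show ?case
    using q_commute_mult_right[of "c ^ n" a "b [^] n" c b] assms by (simp add: mult.commute)
qed (use assms in \<open>simp add: q_commute_one_right\<close>)

lemma pow_smult: "a \<in> carrier A \<Longrightarrow> (c \<odot> a) [^] (n::nat) = (c ^ n) \<odot> (a [^] n)"
  by (induction n) (simp_all add: smult_mult_left smult_mult_right smult_smult mult.commute)

text \<open>
  Moving every \<open>b\<close> to the right past every \<open>a\<close> only costs powers of \<open>c\<close>.  In particular \<open>a b\<close> is
  nilpotent if \<open>a\<close> is, whatever the scalar \<open>d\<close> may be.
\<close>

lemma q_commute_pow_mult:
  assumes "q_commute A c b a" "a \<in> carrier A" "b \<in> carrier A"
  shows "\<exists>d. (a \<otimes> b) [^] (n::nat) = d \<odot> (a [^] n \<otimes> b [^] n)"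
proof (induction n)
  case 0
  show ?case by (intro exI[of _ 1]) simp
next
  case (Suc n)
  then obtain d where d: "(a \<otimes> b) [^] n = d \<odot> (a [^] n \<otimes> b [^] n)" ..
  have bn: "b [^] n \<otimes> a = (c ^ n) \<odot> (a \<otimes> b [^] n)"
    using q_commute_pow_left[OF assms(1,3,2)] by (simp add: q_commute_def)
  have "(a \<otimes> b) [^] Suc n = d \<odot> (a [^] n \<otimes> (b [^] n \<otimes> a) \<otimes> b)"
    using assms(2,3) by (simp add: d smult_mult_left m_assoc)
  also have "\<dots> = (d * c ^ n) \<odot> (a [^] Suc n \<otimes> b [^] Suc n)"
    using assms(2,3) by (simp add: bn smult_mult_left smult_mult_right smult_smult m_assoc)
  finally show ?case ..
qed

end

subsection \<open>The quantum binomial formula\<close>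

text \<open>
  The recursion records how the coefficients change when a normally ordered sum of terms
  \<open>u\<^sup>k v\<^sup>m\<close> is multiplied by \<open>u + v\<close> from the left, where \<open>v u = w u v\<close>.
\<close>

fun gaussian_binomial :: "'k::field \<Rightarrow> nat \<Rightarrow> nat \<Rightarrow> 'k" where
  "gaussian_binomial w n 0 = 1"
| "gaussian_binomial w 0 (Suc k) = 0"
| "gaussian_binomial w (Suc n) (Suc k) = gaussian_binomial w n k + w ^ Suc k * gaussian_binomial w n (Suc k)"

lemma gaussian_binomial_eq_0: "n < k \<Longrightarrow> gaussian_binomial w n k = 0"
  by (induction w n k rule: gaussian_binomial.induct) auto

lemma gaussian_binomial_self [simp]: "gaussian_binomial w n n = 1"
  by (induction n) (auto simp: gaussian_binomial_eq_0)

text \<open>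
  This is the quantum version of \<open>(n choose k) k! (n - k)! = n!\<close>, with the quantum integers
  \<open>(1 - w\<^sup>i) / (1 - w)\<close> multiplied by \<open>1 - w\<close> to avoid the case distinction for \<open>w = 1\<close>.  The inductive step
  rests on \<open>1 - w\<^sup>n\<^sup>+\<^sup>1 = (1 - w\<^sup>k\<^sup>+\<^sup>1) + w\<^sup>k\<^sup>+\<^sup>1 (1 - w\<^sup>n\<^sup>-\<^sup>k)\<close>.
\<close>

lemma gaussian_binomial_fact:
  fixes w :: "'k::field"
  assumes "k \<le> n"
  shows "gaussian_binomial w n k * (\<Prod>i=1..k. 1 - w ^ i) * (\<Prod>i=1..n-k. 1 - w ^ i) = (\<Prod>i=1..n. 1 - w ^ i)"
  using assms
proof (induction w n k rule: gaussian_binomial.induct)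
  case (3 w n k)
  show ?case
  proof (cases "k = n")
    case False
    with 3(3) have k: "k < n" by simp
    then have nk: "n - k = Suc (n - Suc k)" by simp
    let ?p = "\<lambda>m. \<Prod>i=1..m. 1 - w ^ i"
    have p: "?p (Suc m) = ?p m * (1 - w ^ Suc m)" for m
      by (simp add: prod.nat_ivl_Suc')
    have "gaussian_binomial w (Suc n) (Suc k) * ?p (Suc k) * ?p (n - k)
        = (1 - w ^ Suc k) * (gaussian_binomial w n k * ?p k * ?p (n - k))
        + w ^ Suc k * (1 - w ^ (n - k)) * (gaussian_binomial w n (Suc k) * ?p (Suc k) * ?p (n - Suc k))"
      unfolding gaussian_binomial.simps p[of k] p[of "n - Suc k", folded nk] by (simp add: algebra_simps)
    also have "\<dots> = (1 - w ^ Suc k) * ?p n + w ^ Suc k * (1 - w ^ (n - k)) * ?p n"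
      using 3 k by simp
    also have "\<dots> = (1 - w ^ Suc k * w ^ (n - k)) * ?p n"
      by (simp add: algebra_simps)
    also have "\<dots> = ?p (Suc n)"
      using k by (simp add: p power_add[symmetric] mult.commute)
    finally show ?thesis by simp
  qed (simp add: gaussian_binomial_eq_0)
qed auto

text \<open>
  In \<open>gaussian_binomial_fact\<close> the right-hand side contains the factor \<open>1 - w\<^sup>n = 0\<close>, while all factors
  \<open>1 - w\<^sup>i\<close> on the left have \<open>0 < i < n\<close> and are nonzero.
\<close>

lemma gaussian_binomial_root_of_unity:
  fixes w :: "'k::field"
  assumes "primitive_root_of_unity n w" "0 < k" "k < n"
  shows "gaussian_binomial w n k = 0"
proof -
  have nz: "(\<Prod>i=1..m. 1 - w ^ i) \<noteq> 0" if "m < n" for m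
    using that assms(1) by (auto simp: primitive_root_of_unity_def)
  have zero: "(\<Prod>i=1..n. 1 - w ^ i) = 0"
    using assms by (auto simp: primitive_root_of_unity_def prod_zero_iff intro!: bexI[of _ n])
  have "gaussian_binomial w n k * (\<Prod>i=1..k. 1 - w ^ i) * (\<Prod>i=1..n-k. 1 - w ^ i) = 0"
    unfolding gaussian_binomial_fact[OF less_imp_le[OF assms(3)]] by (rule zero)
  moreover have "n - k < n" using assms(2,3) by simp
  ultimately show ?thesis
    using nz[OF assms(3)] nz[of "n - k"] by (metis mult_eq_0_iff)
qed

context k_algebra
begin

lemma q_binomial:
  assumes "q_commute A w v u" "u \<in> carrier A" "v \<in> carrier A"
  shows "(u \<oplus> v) [^] n = (\<Oplus>k\<in>{..n}. gaussian_binomial w n k \<odot> (u [^] k \<otimes> v [^] (n - k)))"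
proof (induction n)
  case (Suc n)
  let ?b = "gaussian_binomial w"
  let ?f = "\<lambda>k. ?b n k \<odot> (u [^] k \<otimes> v [^] (n - k))"
  let ?h = "\<lambda>k. (w ^ k * ?b n k) \<odot> (u [^] k \<otimes> v [^] (Suc n - k))"
  let ?s = "\<lambda>k. ?b n k \<odot> (u [^] Suc k \<otimes> v [^] (n - k))"
  let ?g = "\<lambda>k. ?b (Suc n) k \<odot> (u [^] k \<otimes> v [^] (Suc n - k))"
  note carr = assms(2,3)
  have "(u \<oplus> v) [^] Suc n = (u \<oplus> v) \<otimes> (\<Oplus>k\<in>{..n}. ?f k)"
    using carr by (simp only: nat_pow_Suc2[OF a_closed] Suc.IH)
  also have "\<dots> = (\<Oplus>k\<in>{..n}. u \<otimes> ?f k) \<oplus> (\<Oplus>k\<in>{..n}. v \<otimes> ?f k)"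
    using carr by (simp add: l_distr finsum_rdistr)
  also have "(\<Oplus>k\<in>{..n}. u \<otimes> ?f k) = (\<Oplus>k\<in>{..n}. ?s k)"
    by (rule finsum_cong') (use carr in \<open>simp_all add: smult_mult_right m_assoc[symmetric]
      nat_pow_Suc2[symmetric] del: nat_pow_Suc\<close>)
  also have "(\<Oplus>k\<in>{..n}. v \<otimes> ?f k) = (\<Oplus>k\<in>{..n}. ?h k)"
  proof (rule finsum_cong')
    fix k assume k: "k \<in> {..n}"
    have "q_commute A (w ^ k) v (u [^] k)"
      using assms(1) carr(2,1) by (rule q_commute_pow_right)
    then have vu: "v \<otimes> u [^] k = (w ^ k) \<odot> (u [^] k \<otimes> v)" by (simp add: q_commute_def)
    have "v \<otimes> ?f k = ?b n k \<odot> ((v \<otimes> u [^] k) \<otimes> v [^] (n - k))"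
      using carr by (simp add: smult_mult_right m_assoc)
    also have "\<dots> = ?h k"
      using carr k by (simp add: vu smult_mult_left smult_smult m_assoc mult.commute
          nat_pow_Suc2[symmetric] Suc_diff_le del: nat_pow_Suc)
    finally show "v \<otimes> ?f k = ?h k" .
  qed (use carr in auto)
  also have "(\<Oplus>k\<in>{..n}. ?h k) = (\<Oplus>k\<in>{..Suc n}. ?h k)"
    using carr by (simp add: finsum_Suc gaussian_binomial_eq_0)
  also have "\<dots> = (\<Oplus>k\<in>{..n}. ?h (Suc k)) \<oplus> ?h 0"
    using carr by (intro finsum_Suc2) auto
  also have "(\<Oplus>k\<in>{..n}. ?s k) \<oplus> ((\<Oplus>k\<in>{..n}. ?h (Suc k)) \<oplus> ?h 0)
      = ((\<Oplus>k\<in>{..n}. ?s k) \<oplus> (\<Oplus>k\<in>{..n}. ?h (Suc k))) \<oplus> ?h 0"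
    using carr by (intro a_assoc[symmetric] finsum_closed) auto
  also have "\<dots> = (\<Oplus>k\<in>{..n}. ?s k \<oplus> ?h (Suc k)) \<oplus> ?h 0"
    using carr by (subst finsum_addf) auto
  also have "(\<Oplus>k\<in>{..n}. ?s k \<oplus> ?h (Suc k)) = (\<Oplus>k\<in>{..n}. ?g (Suc k))"
    by (rule finsum_cong') (use carr in \<open>auto simp: smult_add_left\<close>)
  also have "\<dots> \<oplus> ?h 0 = (\<Oplus>k\<in>{..Suc n}. ?g k)"
    using carr by (subst finsum_Suc2) auto
  finally show ?case .
qed simp

lemma q_binomial_root_of_unity:
  assumes "q_commute A w v u" "u \<in> carrier A" "v \<in> carrier A" "primitive_root_of_unity n w"
  shows "(u \<oplus> v) [^] n = u [^] n \<oplus> v [^] n"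
proof -
  let ?f = "\<lambda>k. gaussian_binomial w n k \<odot> (u [^] k \<otimes> v [^] (n - k))"
  have n: "0 < n" using assms(4) by (simp add: primitive_root_of_unity_def)
  have "(\<Oplus>k\<in>{..n}. ?f k) = (\<Oplus>k\<in>{0,n}. ?f k)"
    by (rule add.finprod_mono_neutral_cong_right)
      (use assms in \<open>auto simp: gaussian_binomial_root_of_unity\<close>)
  also have "\<dots> = v [^] n \<oplus> u [^] n"
    using assms(2,3) n by simp
  finally show ?thesis
    using q_binomial[OF assms(1-3)] assms(2,3) by (simp add: a_comm)
qed

end

section \<open>Powers of elements of finite order\<close>

lemma powi_eqI:
  fixes z :: "'k::field"
  assumes "z ^ N = 1" "int N dvd a - b"
  shows "z powi a = z powi b"
proof (cases "z = 0")
  case False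
  from assms(2) obtain k where "a - b = int N * k" by (rule dvdE)
  then have "a = b + int N * k" by simp
  then show ?thesis
    using False assms(1) by (simp add: power_int_add power_int_mult)
qed (use assms in \<open>cases N, auto\<close>)

lemma powi_power_eq_1: "(z::'k::field) ^ N = 1 \<Longrightarrow> (z powi a) ^ N = 1"
  by (simp add: power_int_power' mult.commute[of a] power_int_mult)

lemma powi_eq_nat_mod:
  fixes z :: "'k::field"
  assumes "z ^ N = 1" "0 < N"
  shows "z powi a = z ^ nat (a mod int N)"
proof -
  have "z powi a = z powi (a mod int N)"
    using assms(1) by (rule powi_eqI) (simp add: minus_mod_eq_mult_div)
  then show ?thesis using assms(2) by (simp add: power_int_nonneg_exp)
qed

lemma powi_eq_1_iff:
  fixes q :: "'k::field"
  assumes "primitive_root_of_unity N q"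
  shows "q powi a = 1 \<longleftrightarrow> int N dvd a"
proof
  have N: "q ^ N = 1" "0 < N" "\<And>m. 0 < m \<Longrightarrow> m < N \<Longrightarrow> q ^ m \<noteq> 1"
    using assms by (auto simp: primitive_root_of_unity_def)
  assume "q powi a = 1"
  then have "q ^ nat (a mod int N) = 1" using N by (simp add: powi_eq_nat_mod)
  moreover have "nat (a mod int N) < N" using N(2) by (simp add: nat_less_iff)
  ultimately have "nat (a mod int N) = 0" using N(3) by blast
  then have "a mod int N = 0" using pos_mod_sign[of "int N" a] N(2) by linarith
  then show "int N dvd a" by (simp add: dvd_eq_mod_eq_0)
next
  assume "int N dvd a"
  then show "q powi a = 1"
    using powi_eqI[of q N a 0] assms by (simp add: primitive_root_of_unity_def)
qed

lemma additive_order_dvd_iff: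
  assumes "0 < N"
  shows "additive_order N a dvd m \<longleftrightarrow> int N dvd int m * a"
proof -
  interpret G: group "integer_mod_group N" by simp
  have mem: "a mod int N \<in> carrier (integer_mod_group N)"
    using assms by (simp add: carrier_integer_mod_group)
  have "additive_order N a dvd m \<longleftrightarrow> (a mod int N) [^]\<^bsub>integer_mod_group N\<^esub> m = 0"
    unfolding additive_order_def using G.pow_eq_id[OF mem, of m] by simp
  also have "\<dots> \<longleftrightarrow> int N dvd int m * a"
    by (simp add: mod_mult_right_eq dvd_eq_mod_eq_0)
  finally show ?thesis .
qed

lemma primitive_root_of_unity_powi:
  assumes "primitive_root_of_unity N (q::'k::field)"
  shows "primitive_root_of_unity (additive_order N a) (q powi a)"
proof -
  have N: "0 < N" using assms by (simp add: primitive_root_of_unity_def)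
  have pow: "(q powi a) ^ m = 1 \<longleftrightarrow> additive_order N a dvd m" for m
    using powi_eq_1_iff[OF assms, of "a * int m"] additive_order_dvd_iff[OF N, of a m]
    by (simp add: power_int_power' mult.commute)
  moreover have "0 < additive_order N a"
    using additive_order_dvd_iff[OF N, of a N] N by (intro Nat.gr0I) simp
  ultimately show ?thesis
    unfolding primitive_root_of_unity_def by (auto dest: dvd_imp_le)
qed

lemma additive_order_ge_2:
  assumes "0 < N" "\<not> int N dvd a"
  shows "2 \<le> additive_order N a"
  using additive_order_dvd_iff[OF assms(1), of a 1] additive_order_dvd_iff[OF assms(1), of a N] assms
  by (cases "additive_order N a = 0 \<or> additive_order N a = 1") auto

context k_algebra
begin

context
  fixes g N
  assumes g: "g \<in> carrier A" and gN: "g [^] (N::nat) = \<one>" and N: "0 < N"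
begin

lemma pow_multiple: "N dvd m \<Longrightarrow> g [^] (m::nat) = \<one>"
  using g gN by (auto simp: nat_pow_pow[symmetric])

lemma finite_order_inv:
  assumes "N dvd i + j" shows "inv (g [^] (i::nat)) = g [^] (j::nat)"
  using assms g pow_multiple[of "i + j"] pow_multiple[of "j + i"]
  by (intro inv_unique'[symmetric]) (simp_all add: nat_pow_mult add.commute)

text \<open>
  Here \<open>g\<close> is an invertible element of a ring rather than an element of a group.  Reducing the exponent
  to a natural number makes the laws of natural powers apply to the integer powers in the coproduct and the antipode.
\<close>

lemma int_pow_eq_nat_mod: "g [^] (a::int) = g [^] nat (a mod int N)"
proof (cases "a < 0")
  case True
  have "int N dvd - (a - a mod int N)"
    by (simp only: dvd_minus_iff minus_mod_eq_mult_div dvd_triv_left)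
  then have "int N dvd - a + a mod int N" by simp
  moreover have "- a + a mod int N = int (nat (- a) + nat (a mod int N))" using True N by simp
  ultimately have "N dvd nat (- a) + nat (a mod int N)" by (metis int_dvd_int_iff)
  then have "inv (g [^] nat (- a)) = g [^] nat (a mod int N)" by (rule finite_order_inv)
  then show ?thesis by (simp only: int_pow_def2 True if_True)
next
  case False
  then obtain n where n: "a = int n" by (metis nonneg_int_cases not_less)
  have "g [^] n = g [^] (N * (n div N) + n mod N)" by simp
  also have "\<dots> = g [^] (N * (n div N)) \<otimes> g [^] (n mod N)"
    using g by (rule nat_pow_mult[symmetric])
  also have "\<dots> = g [^] (n mod N)"
    using g pow_multiple[of "N * (n div N)"] by simp
  finally have "g [^] n = g [^] (n mod N)" .
  then show ?thesis
    by (simp add: n int_pow_int zmod_int[symmetric])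
qed

lemma int_pow_closed_finite_order: "g [^] (a::int) \<in> carrier A"
  using g by (simp add: int_pow_eq_nat_mod)

lemma int_pow_neg_mult: "g [^] (a::int) \<otimes> g [^] (- a) = \<one>" "g [^] (- a) \<otimes> g [^] (a::int) = \<one>"
proof -
  let ?i = "nat (a mod int N)" and ?j = "nat (- a mod int N)"
  have "(int ?i + int ?j) mod int N = 0"
    using N by (simp add: mod_add_eq)
  then have "N dvd ?i + ?j"
    by (metis dvd_eq_mod_eq_0 int_dvd_int_iff of_nat_add)
  then show "g [^] a \<otimes> g [^] (- a) = \<one>" "g [^] (- a) \<otimes> g [^] a = \<one>"
    using g pow_multiple[of "?i + ?j"] by (simp_all add: int_pow_eq_nat_mod nat_pow_mult add.commute)
qed

lemma inv_eq_int_pow: "inv g = g [^] (- 1 :: int)"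
  using g by (simp add: int_pow_def2)

lemma q_commute_int_pow_left:
  assumes "q_commute A c g b" "b \<in> carrier A" "c ^ N = 1"
  shows "q_commute A (c powi a) (g [^] (a::int)) b"
  unfolding int_pow_eq_nat_mod powi_eq_nat_mod[OF assms(3) N]
  using assms(1) g assms(2) by (rule q_commute_pow_left)

lemma algebra_hom_int_pow:
  assumes "k_algebra B" "\<phi> \<in> algebra_hom A B"
  shows "\<phi> (g [^] (a::int)) = \<phi> g [^]\<^bsub>B\<^esub> a"
proof -
  interpret B: k_algebra B by fact
  have pow: "\<phi> (g [^] n) = \<phi> g [^]\<^bsub>B\<^esub> n" for n :: nat
    using k_algebra_axioms assms g by (rule algebra_hom_pow)
  have "\<phi> g [^]\<^bsub>B\<^esub> N = \<one>\<^bsub>B\<^esub>"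
    using pow[of N] gN algebra_hom_one[OF assms(2)] by simp
  then show ?thesis
    using B.int_pow_eq_nat_mod[OF algebra_hom_closed[OF assms(2) g] _ N]
    by (simp only: int_pow_eq_nat_mod pow)
qed

end

end

lemma field_algebra_int_pow:
  fixes z :: "'k::field"
  assumes "z ^ N = 1" "0 < N"
  shows "z [^]\<^bsub>field_algebra\<^esub> (a::int) = z powi a"
  using k_algebra.int_pow_eq_nat_mod[OF k_algebra_field, of z N a] assms powi_eq_nat_mod[OF assms]
  by simp

section \<open>Upper triangular matrices\<close>

text \<open>The triple \<open>(a, b, c)\<close> stands for the matrix with rows \<open>(a, b)\<close> and \<open>(0, c)\<close>.\<close>

definition upper_triangular :: "('k::field, 'k \<times> 'k \<times> 'k) module" where
  "upper_triangular =
     \<lparr>carrier = UNIV,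
      monoid.mult = (\<lambda>(a, b, c) (a', b', c'). (a * a', a * b' + b * c', c * c')),
      one = (1, 0, 1),
      ring.zero = (0, 0, 0),
      add = (\<lambda>(a, b, c) (a', b', c'). (a + a', b + b', c + c')),
      module.smult = (\<lambda>d (a, b, c). (d * a, d * b, d * c))\<rparr>"

lemma upper_triangular_simps [simp]:
  "carrier upper_triangular = UNIV"
  "(a, b, c) \<otimes>\<^bsub>upper_triangular\<^esub> (a', b', c') = (a * a', a * b' + b * c', c * c')"
  "\<one>\<^bsub>upper_triangular\<^esub> = (1, 0, 1)"
  "\<zero>\<^bsub>upper_triangular\<^esub> = (0, 0, 0)"
  "(a, b, c) \<oplus>\<^bsub>upper_triangular\<^esub> (a', b', c') = (a + a', b + b', c + c')"
  "d \<odot>\<^bsub>upper_triangular\<^esub> (a, b, c) = (d * a, d * b, d * c)"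
  by (simp_all add: upper_triangular_def)

lemma k_algebra_upper_triangular: "k_algebra (upper_triangular :: ('k::field, 'k \<times> 'k \<times> 'k) module)"
proof (intro k_algebra.intro k_algebra_axioms.intro ringI abelian_groupI monoidI)
  fix t :: "'k \<times> 'k \<times> 'k"
  obtain a b c where "t = (a, b, c)" by (cases t)
  then show "\<exists>s\<in>carrier upper_triangular. s \<oplus>\<^bsub>upper_triangular\<^esub> t = \<zero>\<^bsub>upper_triangular\<^esub>"
    by (intro bexI[of _ "(- a, - b, - c)"]) auto
qed (auto simp: algebra_simps)

lemma diagonal_entries_hom:
  "fst \<in> algebra_hom upper_triangular field_algebra"
  "(\<lambda>t. snd (snd t)) \<in> algebra_hom upper_triangular field_algebra"
  by (intro algebra_homI linear_mapI; force)+

section \<open>The generalised Taft algebra by its universal property\<close>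

locale taft =
  fixes N :: nat and q :: "'k::field" and a11 a12 a21 a22 :: int
  assumes root: "primitive_root_of_unity N q"
    and parameters: "taft_parameters N a11 a12 a21 a22"
begin

abbreviation A where "A \<equiv> taft_algebra N q a11 a12 a21 a22"
abbreviation J where "J \<equiv> taft_ideal N q a11 a12 a21 a22"
abbreviation Nx where "Nx \<equiv> additive_order N (a11 * a12)"
abbreviation Ny where "Ny \<equiv> additive_order N (a21 * a22)"

definition gen :: "gen \<Rightarrow> (gen list \<Rightarrow>\<^sub>0 'k) set" where
  "gen s = J +>\<^bsub>free_algebra\<^esub> letter s"

abbreviation g where "g \<equiv> gen Gen_g"
abbreviation x where "x \<equiv> gen Gen_x"
abbreviation y where "y \<equiv> gen Gen_y"

lemma N_pos: "0 < N" and q_pow_N: "q ^ N = 1" and q_nonzero [simp]: "q \<noteq> 0"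
  using root by (auto simp: primitive_root_of_unity_def power_0_left)

definition satisfies_relations :: "('k, 'b, 'm) module_scheme \<Rightarrow> (gen \<Rightarrow> 'b) \<Rightarrow> bool" where
  "satisfies_relations B v \<longleftrightarrow> (\<forall>s. v s \<in> carrier B) \<and>
     v Gen_x [^]\<^bsub>B\<^esub> Nx = \<zero>\<^bsub>B\<^esub> \<and> v Gen_y [^]\<^bsub>B\<^esub> Ny = \<zero>\<^bsub>B\<^esub> \<and> v Gen_g [^]\<^bsub>B\<^esub> N = \<one>\<^bsub>B\<^esub> \<and>
     q_commute B (q powi (a11 * a22)) (v Gen_x) (v Gen_y) \<and>
     q_commute B (q powi a12) (v Gen_g) (v Gen_x) \<and>
     q_commute B (q powi a22) (v Gen_g) (v Gen_y)"

sublocale F: k_algebra "free_algebra :: ('k, gen list \<Rightarrow>\<^sub>0 'k) module"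
  by (rule k_algebra_free)

lemma J_ideal: "ideal J free_algebra"
  unfolding taft_ideal_def by (rule F.genideal_ideal) simp

sublocale J: algebra_ideal "free_algebra :: ('k, gen list \<Rightarrow>\<^sub>0 'k) module" J
  by (intro algebra_ideal.intro J_ideal F.k_algebra_axioms)

lemma A_eq: "A = J.Q"
  by (simp add: taft_algebra_def)

sublocale A: k_algebra A
  unfolding A_eq by (rule J.k_algebra_quotient)

lemma universal_property:
  assumes "k_algebra B" "satisfies_relations B v"
  shows universal_hom: "descend (free_lift B v) \<in> algebra_hom A B"
    and universal_value: "descend (free_lift B v) (gen s) = v s"
proof -
  interpret B: k_algebra B by fact
  have v: "v s \<in> carrier B" for s using assms(2) by (simp add: satisfies_relations_def)
  let ?F = "free_lift B v"
  have hom: "?F \<in> algebra_hom free_algebra B" using v by (rule B.free_lift_algebra_hom)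
  note letter = B.free_lift_letter[OF v]
  note hom_simps = algebra_homD[OF hom] algebra_hom_pow[OF F.k_algebra_axioms assms(1) hom]
    algebra_hom_minus[OF F.k_algebra_axioms assms(1) hom] letter
  have "?F r = \<zero>\<^bsub>B\<^esub>" if "r \<in> taft_relations N q a11 a12 a21 a22" for r
    using that assms(2) v unfolding taft_relations_def Let_def satisfies_relations_def q_commute_def
    by (elim insertE emptyE; simp add: hom_simps B.minus_eq B.r_neg)
  then have kills: "?F i = \<zero>\<^bsub>B\<^esub>" if "i \<in> J" for i
    using F.algebra_hom_genideal[OF assms(1) hom _ _ that[unfolded taft_ideal_def]] by simp
  show "descend ?F \<in> algebra_hom A B"
    unfolding A_eq using assms(1) hom kills by (rule J.descend_algebra_hom)
  show "descend ?F (gen s) = v s"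
    unfolding gen_def using J.descend_coset[OF assms(1) algebra_hom_linear_map[OF hom] kills, of "letter s"]
    by (simp add: letter)
qed

lemma gen_closed [simp, intro]: "gen s \<in> carrier A"
  unfolding gen_def A_eq by (rule J.coset_closed) simp

lemma relations_hold: "satisfies_relations A gen"
proof -
  let ?\<pi> = "(+>\<^bsub>free_algebra\<^esub>) J"
  have hom: "?\<pi> \<in> algebra_hom free_algebra A"
    unfolding A_eq by (rule J.coset_algebra_hom)
  have zero: "\<zero>\<^bsub>A\<^esub> = J" by (simp add: A_eq)
  have kills: "?\<pi> r = \<zero>\<^bsub>A\<^esub>" if "r \<in> taft_relations N q a11 a12 a21 a22" for r
    unfolding zero
    using F.genideal_self[of "taft_relations N q a11 a12 a21 a22"] that
    by (intro J.a_rcos_const) (auto simp: taft_ideal_def)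
  note hom_simps = algebra_homD[OF hom] algebra_hom_pow[OF F.k_algebra_axioms A.k_algebra_axioms hom]
    algebra_hom_minus[OF F.k_algebra_axioms A.k_algebra_axioms hom]
  have eq: "a = b" if "a \<ominus>\<^bsub>A\<^esub> b = \<zero>\<^bsub>A\<^esub>" "a \<in> carrier A" "b \<in> carrier A" for a b
    using that by (metis A.add.inv_solve_right' A.l_zero A.minus_eq A.zero_closed)
  have "\<forall>r\<in>taft_relations N q a11 a12 a21 a22. ?\<pi> r = \<zero>\<^bsub>A\<^esub>" using kills by blast
  then show ?thesis
    unfolding taft_relations_def Let_def satisfies_relations_def q_commute_def
    by (auto simp: hom_simps gen_def[symmetric] intro: eq)
qed

lemma x_nilpotent: "x [^]\<^bsub>A\<^esub> Nx = \<zero>\<^bsub>A\<^esub>" and y_nilpotent: "y [^]\<^bsub>A\<^esub> Ny = \<zero>\<^bsub>A\<^esub>"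
  and g_order: "g [^]\<^bsub>A\<^esub> N = \<one>\<^bsub>A\<^esub>"
  and xy_commute: "q_commute A (q powi (a11 * a22)) x y"
  and gx_commute: "q_commute A (q powi a12) g x" and gy_commute: "q_commute A (q powi a22) g y"
  using relations_hold by (simp_all add: satisfies_relations_def)

lemma word_closed: "J +>\<^bsub>free_algebra\<^esub> p \<in> carrier A"
  unfolding A_eq by (rule J.coset_closed) simp

text \<open>
  The classes of words span the algebra, so a linear subspace that contains \<open>1\<close> and is stable under
  multiplication by generators from one side is everything.
\<close>

lemma word_span:
  assumes "h \<in> carrier A"
    and word: "\<And>w. P (J +>\<^bsub>free_algebra\<^esub> Poly_Mapping.single w 1)"
    and add: "\<And>h h'. h \<in> carrier A \<Longrightarrow> h' \<in> carrier A \<Longrightarrow> P h \<Longrightarrow> P h' \<Longrightarrow> P (h \<oplus>\<^bsub>A\<^esub> h')"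
    and smult: "\<And>c h. h \<in> carrier A \<Longrightarrow> P h \<Longrightarrow> P (c \<odot>\<^bsub>A\<^esub> h)"
  shows "P h"
proof -
  have smult_word: "c \<odot>\<^bsub>A\<^esub> (J +>\<^bsub>free_algebra\<^esub> Poly_Mapping.single w 1)
      = J +>\<^bsub>free_algebra\<^esub> Poly_Mapping.single w c" for w c
    unfolding A_eq by (simp add: J.coset_smult, simp add: free_algebra_def map_times_single)
  obtain p where p: "h = J +>\<^bsub>free_algebra\<^esub> p"
    using assms(1) unfolding A_eq by (rule J.coset_cases)
  have "Poly_Mapping.keys p \<subseteq> UNIV" by simp
  then have "P (J +>\<^bsub>free_algebra\<^esub> p)"
  proof (induction p rule: poly_mapping_subset_induct)
    case zero
    then show ?case using smult[OF word_closed word, of 0 "[]"] smult_word[of 0 "[]"] by simp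
  next
    case (single u c)
    then show ?case using smult[OF word_closed word, of c u] smult_word[of c u] by simp
  next
    case (add p r)
    have "(J +>\<^bsub>free_algebra\<^esub> p) \<oplus>\<^bsub>A\<^esub> (J +>\<^bsub>free_algebra\<^esub> r) = J +>\<^bsub>free_algebra\<^esub> (p + r)"
      unfolding A_eq by (subst J.coset_add) (simp_all, simp add: free_algebra_def)
    then show ?case using assms(3)[OF word_closed word_closed add(3,4)] by simp
  qed
  then show ?thesis using p by simp
qed

lemma word_append: "J +>\<^bsub>free_algebra\<^esub> Poly_Mapping.single (u @ w) 1
    = (J +>\<^bsub>free_algebra\<^esub> Poly_Mapping.single u 1) \<otimes>\<^bsub>A\<^esub> (J +>\<^bsub>free_algebra\<^esub> Poly_Mapping.single w 1)"
  unfolding A_eq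
  by (subst J.coset_mult) (simp_all, simp add: free_algebra_def monoid_algebra_mult_single)

lemma word_empty: "J +>\<^bsub>free_algebra\<^esub> Poly_Mapping.single [] 1 = \<one>\<^bsub>A\<^esub>"
  unfolding A_eq by (simp add: free_algebra_def)

lemma word_letter: "J +>\<^bsub>free_algebra\<^esub> Poly_Mapping.single [s] 1 = gen s"
  by (simp add: gen_def letter_def)

lemma left_induct [consumes 1, case_names one add smult mult]:
  assumes "h \<in> carrier A"
    and one: "P \<one>\<^bsub>A\<^esub>"
    and add: "\<And>h h'. h \<in> carrier A \<Longrightarrow> h' \<in> carrier A \<Longrightarrow> P h \<Longrightarrow> P h' \<Longrightarrow> P (h \<oplus>\<^bsub>A\<^esub> h')"
    and smult: "\<And>c h. h \<in> carrier A \<Longrightarrow> P h \<Longrightarrow> P (c \<odot>\<^bsub>A\<^esub> h)"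
    and mult: "\<And>s h. h \<in> carrier A \<Longrightarrow> P h \<Longrightarrow> P (gen s \<otimes>\<^bsub>A\<^esub> h)"
  shows "P h"
  using assms(1)
proof (rule word_span)
  show "P (J +>\<^bsub>free_algebra\<^esub> Poly_Mapping.single w 1)" for w
  proof (induction w)
    case (Cons s w)
    then show ?case using mult[OF word_closed Cons] word_append[of "[s]" w] by (simp add: word_letter)
  qed (simp add: word_empty one)
qed (use add smult in auto)

lemma right_induct [consumes 1, case_names one add smult mult]:
  assumes "h \<in> carrier A"
    and one: "P \<one>\<^bsub>A\<^esub>"
    and add: "\<And>h h'. h \<in> carrier A \<Longrightarrow> h' \<in> carrier A \<Longrightarrow> P h \<Longrightarrow> P h' \<Longrightarrow> P (h \<oplus>\<^bsub>A\<^esub> h')"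
    and smult: "\<And>c h. h \<in> carrier A \<Longrightarrow> P h \<Longrightarrow> P (c \<odot>\<^bsub>A\<^esub> h)"
    and mult: "\<And>s h. h \<in> carrier A \<Longrightarrow> P h \<Longrightarrow> P (h \<otimes>\<^bsub>A\<^esub> gen s)"
  shows "P h"
  using assms(1)
proof (rule word_span)
  show "P (J +>\<^bsub>free_algebra\<^esub> Poly_Mapping.single w 1)" for w
  proof (induction w rule: rev_induct)
    case (snoc s w)
    then show ?case using mult[OF word_closed snoc] word_append[of w "[s]"] by (simp add: word_letter)
  qed (simp add: word_empty one)
qed (use add smult in auto)

text \<open>
  An algebra homomorphism out of the Taft algebra is determined by three values.  This is what reduces
  identities between composites of structure maps to finite checks.
\<close>

lemma algebra_hom_eqI:
  assumes "\<phi> \<in> algebra_hom A B" "\<psi> \<in> algebra_hom A B" "\<And>s. \<phi> (gen s) = \<psi> (gen s)" "h \<in> carrier A"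
  shows "\<phi> h = \<psi> h"
  using assms(4)
  by (induction h rule: left_induct)
    (simp_all add: algebra_homD[OF assms(1)] algebra_homD[OF assms(2)] assms(3))

subsection \<open>Commutation up to powers of the root of unity\<close>

text \<open>
  All scalars in commutation relations are powers of \<open>q\<close>.  Keeping only the exponent, products add
  exponents, and two exponents matter only modulo \<open>N\<close>.
\<close>

abbreviation qc :: "('k, 'b, 'm) module_scheme \<Rightarrow> int \<Rightarrow> 'b \<Rightarrow> 'b \<Rightarrow> bool" where
  "qc B e \<equiv> q_commute B (q powi e)"

lemma qc_cong: "qc B e a b \<Longrightarrow> int N dvd e - e' \<Longrightarrow> qc B e' a b"
  using powi_eqI[OF q_pow_N, of e e'] by simp

lemma qc_0: "q_commute B 1 a b \<Longrightarrow> qc B 0 a b"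
  by simp

lemma qc_mult_left:
  "k_algebra B \<Longrightarrow> qc B e a b \<Longrightarrow> qc B e' a' b \<Longrightarrow> a \<in> carrier B \<Longrightarrow> a' \<in> carrier B \<Longrightarrow> b \<in> carrier B
    \<Longrightarrow> qc B (e + e') (a \<otimes>\<^bsub>B\<^esub> a') b"
  using k_algebra.q_commute_mult_left[of B "q powi e" a b "q powi e'" a'] by (simp add: power_int_add)

lemma qc_mult_right:
  "k_algebra B \<Longrightarrow> qc B e a b \<Longrightarrow> qc B e' a b' \<Longrightarrow> a \<in> carrier B \<Longrightarrow> b \<in> carrier B \<Longrightarrow> b' \<in> carrier B
    \<Longrightarrow> qc B (e + e') a (b \<otimes>\<^bsub>B\<^esub> b')"
  using k_algebra.q_commute_mult_right[of B "q powi e" a b "q powi e'" b'] by (simp add: power_int_add)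

lemma qc_sym:
  "k_algebra B \<Longrightarrow> qc B e a b \<Longrightarrow> a \<in> carrier B \<Longrightarrow> b \<in> carrier B \<Longrightarrow> qc B (- e) b a"
  using k_algebra.q_commute_sym[of B "q powi e" a b] by (simp add: power_int_minus)

abbreviation gp :: "int \<Rightarrow> (gen list \<Rightarrow>\<^sub>0 'k) set" where
  "gp a \<equiv> g [^]\<^bsub>A\<^esub> a"

lemmas gp_closed [simp, intro] = A.int_pow_closed_finite_order[OF gen_closed g_order N_pos]
lemmas gp_neg_mult = A.int_pow_neg_mult[OF gen_closed g_order N_pos]

lemma qc_gp_left: "qc A e g b \<Longrightarrow> b \<in> carrier A \<Longrightarrow> qc A (e * a) (gp a) b"
  using A.q_commute_int_pow_left[OF gen_closed g_order N_pos, of "q powi e" b a]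
  by (simp add: powi_power_eq_1[OF q_pow_N] power_int_mult)

lemma qc_gp_right: "qc A e g b \<Longrightarrow> b \<in> carrier A \<Longrightarrow> qc A (- (e * a)) b (gp a)"
  by (intro qc_sym A.k_algebra_axioms qc_gp_left) auto

lemma qc_g_gp: "qc A 0 g (gp a)"
  using qc_gp_right[of 0 g a] A.q_commute_refl[of g] by simp

lemma qc_gp_gp: "qc A 0 (gp a) (gp b)"
  using qc_gp_left[of 0 "gp b" a] qc_g_gp[of b] by simp

section \<open>The Hopf structure of the generalised Taft algebra\<close>

sublocale tensor_product A A
  by unfold_locales

lemma qc_tensor:
  assumes "qc A e a a'" "qc A f b b'" "a \<in> carrier A" "a' \<in> carrier A" "b \<in> carrier A" "b' \<in> carrier A"
  shows "qc T (e + f) (tens a b) (tens a' b')"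
  using assms by (simp add: q_commute_def pure_mult pure_smult_left pure_smult_right T.smult_smult
      power_int_add mult.commute)

text \<open>
  The coproduct of a skew-primitive generator \<open>z\<close>; \<open>x\<close> uses \<open>a = a\<^sub>1\<^sub>1\<close> and \<open>y\<close> uses \<open>a = a\<^sub>2\<^sub>1\<close>.
\<close>

definition skew :: "(gen list \<Rightarrow>\<^sub>0 'k) set \<Rightarrow> int \<Rightarrow> ((gen list \<Rightarrow>\<^sub>0 'k) set \<times> (gen list \<Rightarrow>\<^sub>0 'k) set \<Rightarrow>\<^sub>0 'k) set" where
  "skew z a = tens \<one>\<^bsub>A\<^esub> z \<oplus>\<^bsub>T\<^esub> tens z (gp a)"

lemma skew_closed [simp]: "z \<in> carrier A \<Longrightarrow> skew z a \<in> carrier T"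
  by (simp add: skew_def)

text \<open>
  The two summands \<open>1 \<otimes> z\<close> and \<open>z \<otimes> g\<^sup>a\<close> of the coproduct commute up to \<open>q\<^sup>a\<^sup>b\<close>, whose order is
  the nilpotency exponent of \<open>z\<close>.  So the mixed terms of the quantum binomial formula vanish.
\<close>

lemma skew_nilpotent:
  assumes "z \<in> carrier A" "qc A b g z" "z [^]\<^bsub>A\<^esub> additive_order N (a * b) = \<zero>\<^bsub>A\<^esub>"
  shows "skew z a [^]\<^bsub>T\<^esub> additive_order N (a * b) = \<zero>\<^bsub>T\<^esub>"
proof -
  let ?n = "additive_order N (a * b)"
  have "qc T (0 + b * a) (tens z (gp a)) (tens \<one>\<^bsub>A\<^esub> z)"
    using assms(1,2) by (intro qc_tensor qc_gp_left qc_0 A.q_commute_one_right) auto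
  then have "q_commute T (q powi (a * b)) (tens z (gp a)) (tens \<one>\<^bsub>A\<^esub> z)"
    by (simp add: mult.commute)
  then have "skew z a [^]\<^bsub>T\<^esub> ?n = tens \<one>\<^bsub>A\<^esub> z [^]\<^bsub>T\<^esub> ?n \<oplus>\<^bsub>T\<^esub> tens z (gp a) [^]\<^bsub>T\<^esub> ?n"
    unfolding skew_def using assms(1) primitive_root_of_unity_powi[OF root]
    by (intro T.q_binomial_root_of_unity) auto
  then show ?thesis
    using assms(1,3) by (simp add: pure_pow pure_zero)
qed

lemma g_skew_commute:
  assumes "z \<in> carrier A" "qc A b g z"
  shows "qc T b (tens g g) (skew z a)"
proof -
  have "qc T (0 + b) (tens g g) (tens \<one>\<^bsub>A\<^esub> z)"
    using assms by (intro qc_tensor qc_0 A.q_commute_one_right) auto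
  moreover have "qc T (b + 0) (tens g g) (tens z (gp a))"
    using assms qc_g_gp by (intro qc_tensor) auto
  ultimately show ?thesis
    unfolding skew_def using assms(1) by (intro T.q_commute_add_right) auto
qed

lemma parameter_relation: "int N dvd a11 * a22 + a12 * a21"
  using parameters by (simp add: taft_parameters_def)

text \<open>
  Each summand of \<open>\<Delta> x\<close> commutes with each summand of \<open>\<Delta> y\<close> up to a power of \<open>q\<close>.  Three of the four
  exponents are \<open>a\<^sub>1\<^sub>1 a\<^sub>2\<^sub>2\<close>.  The fourth, from \<open>1 \<otimes> x\<close> and \<open>y \<otimes> g\<^sup>a\<close> with \<open>a = a\<^sub>2\<^sub>1\<close>, is \<open>- a\<^sub>1\<^sub>2 a\<^sub>2\<^sub>1\<close>, and the
  condition on the parameter matrix says that this is the same modulo \<open>N\<close>.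
\<close>

lemma skew_commute: "qc T (a11 * a22) (skew x a11) (skew y a21)"
proof -
  have "qc T (0 + a11 * a22) (tens \<one>\<^bsub>A\<^esub> x) (tens \<one>\<^bsub>A\<^esub> y)"
    by (intro qc_tensor qc_0 A.q_commute_refl xy_commute) auto
  moreover have "qc T (a11 * a22) (tens \<one>\<^bsub>A\<^esub> x) (tens y (gp a21))"
  proof (rule qc_cong)
    show "qc T (0 + - (a12 * a21)) (tens \<one>\<^bsub>A\<^esub> x) (tens y (gp a21))"
      by (intro qc_tensor qc_0 A.q_commute_one_left qc_gp_right gx_commute) auto
    have "0 + - (a12 * a21) - a11 * a22 = - (a11 * a22 + a12 * a21)" by simp
    then show "int N dvd 0 + - (a12 * a21) - a11 * a22"
      using parameter_relation by (simp only: dvd_minus_iff)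
  qed
  moreover have "qc T (0 + a22 * a11) (tens x (gp a11)) (tens \<one>\<^bsub>A\<^esub> y)"
    by (intro qc_tensor qc_0 A.q_commute_one_right qc_gp_left gy_commute) auto
  moreover have "qc T (a11 * a22 + 0) (tens x (gp a11)) (tens y (gp a21))"
    by (intro qc_tensor xy_commute qc_gp_gp) auto
  ultimately show ?thesis
    unfolding skew_def by (intro T.q_commute_add_left T.q_commute_add_right) (auto simp: mult.commute)
qed

abbreviation H where "H \<equiv> taft_hopf N q a11 a12 a21 a22"

lemma hopf_algebra_simps [simp]:
  "carrier H = carrier A" "\<one>\<^bsub>H\<^esub> = \<one>\<^bsub>A\<^esub>" "\<zero>\<^bsub>H\<^esub> = \<zero>\<^bsub>A\<^esub>"
  "monoid.mult H = monoid.mult A" "add H = add A" "module.smult H = module.smult A"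
  by (simp_all add: taft_hopf_def Let_def module.defs hopf.defs)

definition comult_gen where
  "comult_gen = case_gen (tens g g) (skew x a11) (skew y a21)"

definition antipode_gen where
  "antipode_gen = case_gen (gp (- 1)) (\<ominus>\<^bsub>A\<^esub> (x \<otimes>\<^bsub>A\<^esub> gp (- a11))) (\<ominus>\<^bsub>A\<^esub> (y \<otimes>\<^bsub>A\<^esub> gp (- a21)))"

lemma hopf_structure_simps:
  "comult H = descend (free_lift T comult_gen)"
  "counit H = descend (free_lift field_algebra (case_gen 1 0 0))"
  "antipode H = descend (free_lift (opposite A) antipode_gen)"
  by (simp_all add: taft_hopf_def Let_def module.defs hopf.defs comult_gen_def antipode_gen_def
      skew_def gen_def[symmetric] A.inv_eq_int_pow[OF gen_closed g_order N_pos])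

lemma comult_gen_relations: "satisfies_relations T comult_gen"
proof -
  have "comult_gen s \<in> carrier T" for s
    by (cases s) (auto simp: comult_gen_def)
  then show ?thesis
    unfolding satisfies_relations_def
    using skew_nilpotent[OF gen_closed gx_commute x_nilpotent]
      skew_nilpotent[OF gen_closed gy_commute y_nilpotent]
      g_skew_commute[OF gen_closed gx_commute] g_skew_commute[OF gen_closed gy_commute] skew_commute
    by (simp add: comult_gen_def pure_pow g_order pure_one)
qed

lemma comult_hom: "comult H \<in> algebra_hom A T"
  and comult_value: "comult H (gen s) = comult_gen s"
  using universal_property[OF T.k_algebra_axioms comult_gen_relations]
  by (simp_all add: hopf_structure_simps)

lemma field_relations:
  assumes "z ^ N = 1"
  shows "satisfies_relations field_algebra (case_gen z 0 0)"
proof -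
  have "0 < Nx" "0 < Ny"
    using additive_order_ge_2[OF N_pos] parameters by (force simp: taft_parameters_def)+
  moreover have "case_gen z 0 0 s \<in> carrier field_algebra" for s by (simp add: field_algebra_simps)
  ultimately show ?thesis
    using assms by (simp add: satisfies_relations_def q_commute_def zero_power)
qed

lemma counit_hom: "counit H \<in> algebra_hom A field_algebra"
  and counit_value: "counit H (gen s) = (case s of Gen_g \<Rightarrow> 1 | Gen_x \<Rightarrow> 0 | Gen_y \<Rightarrow> 0)"
  using universal_property[OF k_algebra_field field_relations[of 1]]
  by (simp_all add: hopf_structure_simps)

lemma q_commute_opposite: "q_commute (opposite A) c a b \<longleftrightarrow> q_commute A c b a"
  by (simp add: q_commute_def)

text \<open>
  In the opposite algebra the relation between \<open>x\<close> and \<open>y\<close> becomes one between \<open>S y\<close> and \<open>S x\<close> in the original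
  order.  Its exponent is again \<open>- a\<^sub>1\<^sub>2 a\<^sub>2\<^sub>1\<close>, which is \<open>a\<^sub>1\<^sub>1 a\<^sub>2\<^sub>2\<close> modulo \<open>N\<close>.
\<close>

lemma antipode_gen_relations: "satisfies_relations (opposite A) antipode_gen"
proof -
  have nilpotent: "(\<ominus>\<^bsub>A\<^esub> (z \<otimes>\<^bsub>A\<^esub> gp a)) [^]\<^bsub>A\<^esub> (n::nat) = \<zero>\<^bsub>A\<^esub>"
    if z: "z \<in> carrier A" "qc A b g z" "z [^]\<^bsub>A\<^esub> n = \<zero>\<^bsub>A\<^esub>" for z a b n
  proof -
    obtain d where "(z \<otimes>\<^bsub>A\<^esub> gp a) [^]\<^bsub>A\<^esub> n = d \<odot>\<^bsub>A\<^esub> (z [^]\<^bsub>A\<^esub> n \<otimes>\<^bsub>A\<^esub> gp a [^]\<^bsub>A\<^esub> n)"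
      using A.q_commute_pow_mult[OF qc_gp_left[OF z(2,1)] z(1)] by blast
    then show ?thesis
      using z by (simp add: A.smult_minus_one[symmetric] A.pow_smult del: A.add.inv_closed)
  qed
  have "qc A (a11 * a22) (y \<otimes>\<^bsub>A\<^esub> gp (- a21)) (x \<otimes>\<^bsub>A\<^esub> gp (- a11))"
  proof (rule qc_cong)
    show "qc A ((- (a11 * a22) + a12 * - a21) + (- (a22 * - a11) + 0)) (y \<otimes>\<^bsub>A\<^esub> gp (- a21)) (x \<otimes>\<^bsub>A\<^esub> gp (- a11))"
      by (intro qc_mult_right qc_mult_left A.k_algebra_axioms qc_gp_gp qc_gp_right gy_commute
          qc_gp_left gx_commute qc_sym xy_commute A.m_closed gen_closed gp_closed)
    have "(- (a11 * a22) + a12 * - a21) + (- (a22 * - a11) + 0) - a11 * a22 = - (a11 * a22 + a12 * a21)"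
      by (simp add: algebra_simps)
    then show "int N dvd (- (a11 * a22) + a12 * - a21) + (- (a22 * - a11) + 0) - a11 * a22"
      using parameter_relation by (simp only: dvd_minus_iff)
  qed
  then have xy: "qc A (a11 * a22) (\<ominus>\<^bsub>A\<^esub> (y \<otimes>\<^bsub>A\<^esub> gp (- a21))) (\<ominus>\<^bsub>A\<^esub> (x \<otimes>\<^bsub>A\<^esub> gp (- a11)))"
    by (intro A.q_commute_minus_left A.q_commute_minus_right) auto
  have gz: "qc A b (\<ominus>\<^bsub>A\<^esub> (z \<otimes>\<^bsub>A\<^esub> gp a)) (gp (- 1))" if "z \<in> carrier A" "qc A b g z" for z a b
  proof -
    have "qc A (- (b * - 1) + 0) (z \<otimes>\<^bsub>A\<^esub> gp a) (gp (- 1))"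
      using that by (intro qc_mult_left A.k_algebra_axioms qc_gp_right qc_gp_gp) auto
    then show ?thesis
      using that by (intro A.q_commute_minus_left) auto
  qed
  have "antipode_gen s \<in> carrier A" for s
    by (cases s) (auto simp: antipode_gen_def)
  moreover have "gp (- 1) [^]\<^bsub>A\<^esub> N = \<one>\<^bsub>A\<^esub>"
    using A.int_pow_eq_nat_mod[OF gen_closed g_order N_pos, of "- 1"] g_order
    by (simp add: A.nat_pow_pow mult.commute) (metis A.nat_pow_one A.nat_pow_pow gen_closed g_order mult.commute)
  ultimately show ?thesis
    unfolding satisfies_relations_def q_commute_opposite
    using nilpotent[OF gen_closed gx_commute x_nilpotent] nilpotent[OF gen_closed gy_commute y_nilpotent]
      gz[OF gen_closed gx_commute] gz[OF gen_closed gy_commute] xy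
    by (simp add: antipode_gen_def A.opposite_pow)
qed

lemma antipode_hom: "antipode H \<in> algebra_hom A (opposite A)"
  and antipode_value: "antipode H (gen s) = antipode_gen s"
  using universal_property[OF A.k_algebra_opposite antipode_gen_relations]
  by (simp_all add: hopf_structure_simps)

section \<open>Sweedler sums and the antipode axiom\<close>

lemma linear_extension_H: "linear_extension H f = linear_extension A f"
  by (simp add: fun_eq_iff linear_extension_def finsum_def finprod_def)

lemma sweedler_H: "sweedler2 H H f = sweedler2 H A f"
  by (intro ext) (simp add: sweedler2_def tensor_elim_def linear_extension_H)

lemma sweedler_algebra_hom:
  assumes "k_algebra U" "f \<in> bilinear_map A A U"
    and "\<And>a a' b b'. a \<in> carrier A \<Longrightarrow> a' \<in> carrier A \<Longrightarrow> b \<in> carrier A \<Longrightarrow> b' \<in> carrier A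
      \<Longrightarrow> f (a \<otimes>\<^bsub>A\<^esub> a') (b \<otimes>\<^bsub>A\<^esub> b') = f a b \<otimes>\<^bsub>U\<^esub> f a' b'"
    and "f \<one>\<^bsub>A\<^esub> \<one>\<^bsub>A\<^esub> = \<one>\<^bsub>U\<^esub>"
  shows "sweedler2 H U f \<in> algebra_hom A U"
  unfolding sweedler2_def
  using A.k_algebra_axioms comult_hom tensor_elim_algebra_hom[OF assms] by (rule algebra_hom_comp)

lemma tensor_elim_skew:
  assumes "k_algebra U" "f \<in> bilinear_map A A U" "z \<in> carrier A"
  shows "tensor_elim U f (skew z a) = f \<one>\<^bsub>A\<^esub> z \<oplus>\<^bsub>U\<^esub> f z (gp a)"
  unfolding skew_def
  using assms(3) by (simp add: linear_map_add[OF tensor_elim_linear_map[OF assms(1,2)]]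
      tensor_elim_pure[OF assms(1,2)])

lemma sweedler_values:
  assumes "k_algebra U" "f \<in> bilinear_map A A U"
  shows "sweedler2 H U f g = f g g"
    and "sweedler2 H U f x = f \<one>\<^bsub>A\<^esub> x \<oplus>\<^bsub>U\<^esub> f x (gp a11)"
    and "sweedler2 H U f y = f \<one>\<^bsub>A\<^esub> y \<oplus>\<^bsub>U\<^esub> f y (gp a21)"
  by (simp_all add: sweedler2_def comult_value comult_gen_def tensor_elim_pure[OF assms]
      tensor_elim_skew[OF assms])

lemma comult_gp: "comult H (gp a) = tens (gp a) (gp a)"
proof -
  have "tens g g [^]\<^bsub>T\<^esub> N = \<one>\<^bsub>T\<^esub>"
    by (simp add: pure_pow g_order pure_one)
  then have "tens g g [^]\<^bsub>T\<^esub> a = tens g g [^]\<^bsub>T\<^esub> nat (a mod int N)"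
    by (intro T.int_pow_eq_nat_mod) (auto simp: N_pos)
  then show ?thesis
    using A.algebra_hom_int_pow[OF gen_closed g_order N_pos T.k_algebra_axioms comult_hom, of a]
      A.int_pow_eq_nat_mod[OF gen_closed g_order N_pos, of a]
    by (simp add: comult_value comult_gen_def pure_pow)
qed

lemma character_gp:
  assumes "\<beta> \<in> algebra_hom A field_algebra"
  shows "\<beta> (gp a) = \<beta> g powi a" and "\<beta> g ^ N = 1"
proof -
  show order: "\<beta> g ^ N = 1"
    using algebra_hom_pow[OF A.k_algebra_axioms k_algebra_field assms gen_closed, of Gen_g N]
      algebra_hom_one[OF assms] by (simp add: g_order)
  show "\<beta> (gp a) = \<beta> g powi a"
    using A.algebra_hom_int_pow[OF gen_closed g_order N_pos k_algebra_field assms, of a]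
    by (simp add: field_algebra_int_pow[OF order N_pos])
qed

abbreviation S where "S \<equiv> antipode H"

lemma S_simps:
  shows S_closed [simp]: "a \<in> carrier A \<Longrightarrow> S a \<in> carrier A"
    and S_add: "a \<in> carrier A \<Longrightarrow> b \<in> carrier A \<Longrightarrow> S (a \<oplus>\<^bsub>A\<^esub> b) = S a \<oplus>\<^bsub>A\<^esub> S b"
    and S_smult: "a \<in> carrier A \<Longrightarrow> S (c \<odot>\<^bsub>A\<^esub> a) = c \<odot>\<^bsub>A\<^esub> S a"
    and S_mult: "a \<in> carrier A \<Longrightarrow> b \<in> carrier A \<Longrightarrow> S (a \<otimes>\<^bsub>A\<^esub> b) = S b \<otimes>\<^bsub>A\<^esub> S a"
    and S_one: "S \<one>\<^bsub>A\<^esub> = \<one>\<^bsub>A\<^esub>"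
  using algebra_homD[OF antipode_hom] by simp_all

lemma S_gen:
  "S g = gp (- 1)" "S x = \<ominus>\<^bsub>A\<^esub> (x \<otimes>\<^bsub>A\<^esub> gp (- a11))" "S y = \<ominus>\<^bsub>A\<^esub> (y \<otimes>\<^bsub>A\<^esub> gp (- a21))"
  by (simp_all add: antipode_value antipode_gen_def)

lemma g_gp_minus_one: "g \<otimes>\<^bsub>A\<^esub> gp (- 1) = \<one>\<^bsub>A\<^esub>" "gp (- 1) \<otimes>\<^bsub>A\<^esub> g = \<one>\<^bsub>A\<^esub>"
proof -
  have "gp 1 = g"
    using int_pow_int[of A g 1] by simp
  then show "g \<otimes>\<^bsub>A\<^esub> gp (- 1) = \<one>\<^bsub>A\<^esub>" "gp (- 1) \<otimes>\<^bsub>A\<^esub> g = \<one>\<^bsub>A\<^esub>"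
    using gp_neg_mult[of 1] by simp_all
qed

lemma counit_one: "counit H \<one>\<^bsub>A\<^esub> = 1"
  using algebra_hom_one[OF counit_hom] by simp

lemma antipode_bilinear:
  "(\<lambda>a b. S a \<otimes>\<^bsub>A\<^esub> b) \<in> bilinear_map A A A" "(\<lambda>a b. a \<otimes>\<^bsub>A\<^esub> S b) \<in> bilinear_map A A A"
  by (intro bilinear_mapI linear_mapI;
      simp add: S_simps A.l_distr A.r_distr A.smult_mult_left A.smult_mult_right)+

text \<open>
  The map \<open>h \<mapsto> S(h\<^sub>1) h\<^sub>2\<close> is not multiplicative, so the identity cannot be read off the generators.
  But for a generator \<open>s\<close> it sends \<open>s h\<close> to \<open>S(h\<^sub>1) S(s\<^sub>1) s\<^sub>2 h\<^sub>2\<close>, where the inner factor is \<open>\<epsilon>(s)\<close>; induction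
  on words that grow on the left then gives the result.
\<close>

lemma antipode_left:
  assumes "h \<in> carrier A"
  shows "sweedler2 H A (\<lambda>a b. S a \<otimes>\<^bsub>A\<^esub> b) h = counit H h \<odot>\<^bsub>A\<^esub> \<one>\<^bsub>A\<^esub>"
proof -
  let ?f = "\<lambda>a b. S a \<otimes>\<^bsub>A\<^esub> b"
  note bil = antipode_bilinear(1)
  let ?E = "tensor_elim A ?f"
  note lin = linear_mapD[OF tensor_elim_linear_map[OF A.k_algebra_axioms bil]]
  note el = tensor_elim_pure[OF A.k_algebra_axioms bil]
  have skew: "?E (skew z c \<otimes>\<^bsub>T\<^esub> t) = \<zero>\<^bsub>A\<^esub>"
    if z: "z \<in> carrier A" "S z = \<ominus>\<^bsub>A\<^esub> (z \<otimes>\<^bsub>A\<^esub> gp (- c))" and t: "t \<in> carrier T" for z c t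
    using t
  proof (induction t rule: tensor_induct)
    case (pure a b)
    have "S (z \<otimes>\<^bsub>A\<^esub> a) \<otimes>\<^bsub>A\<^esub> (gp c \<otimes>\<^bsub>A\<^esub> b) = \<ominus>\<^bsub>A\<^esub> (S a \<otimes>\<^bsub>A\<^esub> (z \<otimes>\<^bsub>A\<^esub> ((gp (- c) \<otimes>\<^bsub>A\<^esub> gp c) \<otimes>\<^bsub>A\<^esub> b)))"
      using z pure by (simp add: S_mult A.l_minus A.r_minus A.m_assoc)
    also have "\<dots> = \<ominus>\<^bsub>A\<^esub> (S a \<otimes>\<^bsub>A\<^esub> (z \<otimes>\<^bsub>A\<^esub> b))"
      using z pure by (simp add: gp_neg_mult)
    finally show ?case
      using z(1) pure by (simp add: skew_def T.l_distr pure_mult lin el A.r_neg)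
  qed (use z(1) in \<open>simp_all add: lin T.r_distr T.smult_mult_right\<close>)
  have g: "?E (tens g g \<otimes>\<^bsub>T\<^esub> t) = ?E t" if t: "t \<in> carrier T" for t
    using t
  proof (induction t rule: tensor_induct)
    case (pure a b)
    have "S (g \<otimes>\<^bsub>A\<^esub> a) \<otimes>\<^bsub>A\<^esub> (g \<otimes>\<^bsub>A\<^esub> b) = S a \<otimes>\<^bsub>A\<^esub> ((gp (- 1) \<otimes>\<^bsub>A\<^esub> g) \<otimes>\<^bsub>A\<^esub> b)"
      using pure by (simp add: S_mult S_gen A.m_assoc)
    then show ?case
      using pure by (simp add: pure_mult el g_gp_minus_one)
  qed (simp_all add: lin T.r_distr T.smult_mult_right)
  have "?E (comult H h) = counit H h \<odot>\<^bsub>A\<^esub> \<one>\<^bsub>A\<^esub>"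
    using assms
  proof (induction h rule: left_induct)
    case one
    show ?case by (simp add: algebra_hom_one[OF comult_hom] pure_one el S_one counit_one)
  next
    case (mult s h)
    then show ?case
      by (cases s) (simp_all add: algebra_homD[OF comult_hom] algebra_homD[OF counit_hom] comult_value
          comult_gen_def counit_value g skew S_gen)
  qed (simp_all add: algebra_homD[OF comult_hom] algebra_homD[OF counit_hom] lin A.smult_add_left A.smult_smult)
  then show ?thesis by (simp add: sweedler2_def)
qed

lemma S_mult_group_like:
  assumes "l \<in> carrier A" "comult H l = tens l l" "counit H l = 1"
  shows "S l \<otimes>\<^bsub>A\<^esub> l = \<one>\<^bsub>A\<^esub>"
proof -
  note bil = antipode_bilinear(1)
  show ?thesis
    using antipode_left[OF assms(1)] assms tensor_elim_pure[OF A.k_algebra_axioms bil assms(1,1)]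
    by (simp add: sweedler2_def)
qed

text \<open>
  The left inverse of \<open>g\<^sup>a\<close> provided by the antipode is the two-sided inverse \<open>g\<^sup>-\<^sup>a\<close>.
\<close>

lemma S_gp: "S (gp a) = gp (- a)"
proof -
  have "counit H (gp a) = 1"
    using character_gp(1)[OF counit_hom, of a] by (simp add: counit_value)
  then have "S (gp a) \<otimes>\<^bsub>A\<^esub> gp a = \<one>\<^bsub>A\<^esub>"
    by (intro S_mult_group_like comult_gp) auto
  then have "(S (gp a) \<otimes>\<^bsub>A\<^esub> gp a) \<otimes>\<^bsub>A\<^esub> gp (- a) = gp (- a)" by simp
  then show ?thesis by (simp add: A.m_assoc gp_neg_mult)
qed

text \<open>
  The mirror image of \<open>antipode_left\<close>: words grow on the right, and \<open>h s\<close> is sent to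
  \<open>h\<^sub>1 s\<^sub>1 S(s\<^sub>2) S(h\<^sub>2)\<close>.
\<close>

lemma antipode_right:
  assumes "h \<in> carrier A"
  shows "sweedler2 H A (\<lambda>a b. a \<otimes>\<^bsub>A\<^esub> S b) h = counit H h \<odot>\<^bsub>A\<^esub> \<one>\<^bsub>A\<^esub>"
proof -
  let ?f = "\<lambda>a b. a \<otimes>\<^bsub>A\<^esub> S b"
  note bil = antipode_bilinear(2)
  let ?E = "tensor_elim A ?f"
  note lin = linear_mapD[OF tensor_elim_linear_map[OF A.k_algebra_axioms bil]]
  note el = tensor_elim_pure[OF A.k_algebra_axioms bil]
  have skew: "?E (t \<otimes>\<^bsub>T\<^esub> skew z c) = \<zero>\<^bsub>A\<^esub>"
    if z: "z \<in> carrier A" "S z = \<ominus>\<^bsub>A\<^esub> (z \<otimes>\<^bsub>A\<^esub> gp (- c))" and t: "t \<in> carrier T" for z c t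
    using t
  proof (induction t rule: tensor_induct)
    case (pure a b)
    have "a \<otimes>\<^bsub>A\<^esub> S (b \<otimes>\<^bsub>A\<^esub> z) = \<ominus>\<^bsub>A\<^esub> ((a \<otimes>\<^bsub>A\<^esub> z) \<otimes>\<^bsub>A\<^esub> S (b \<otimes>\<^bsub>A\<^esub> gp c))"
      using z pure by (simp add: S_mult S_gp A.l_minus A.r_minus A.m_assoc)
    then show ?case
      using z(1) pure by (simp add: skew_def T.r_distr pure_mult lin el A.l_neg)
  qed (use z(1) in \<open>simp_all add: lin T.l_distr T.smult_mult_left\<close>)
  have g: "?E (t \<otimes>\<^bsub>T\<^esub> tens g g) = ?E t" if t: "t \<in> carrier T" for t
    using t
  proof (induction t rule: tensor_induct)
    case (pure a b)
    have "(a \<otimes>\<^bsub>A\<^esub> g) \<otimes>\<^bsub>A\<^esub> S (b \<otimes>\<^bsub>A\<^esub> g) = a \<otimes>\<^bsub>A\<^esub> ((g \<otimes>\<^bsub>A\<^esub> gp (- 1)) \<otimes>\<^bsub>A\<^esub> S b)"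
      using pure by (simp add: S_mult S_gen A.m_assoc)
    then show ?case
      using pure by (simp add: pure_mult el g_gp_minus_one)
  qed (simp_all add: lin T.l_distr T.smult_mult_left)
  have "?E (comult H h) = counit H h \<odot>\<^bsub>A\<^esub> \<one>\<^bsub>A\<^esub>"
    using assms
  proof (induction h rule: right_induct)
    case one
    show ?case by (simp add: algebra_hom_one[OF comult_hom] pure_one el S_one counit_one)
  next
    case (mult s h)
    then show ?case
      by (cases s) (simp_all add: algebra_homD[OF comult_hom] algebra_homD[OF counit_hom] comult_value
          comult_gen_def counit_value g skew S_gen)
  qed (simp_all add: algebra_homD[OF comult_hom] algebra_homD[OF counit_hom] lin A.smult_add_left A.smult_smult)
  then show ?thesis by (simp add: sweedler2_def)
qed

lemma pure_tensor_H: "pure_tensor H H = tens"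
proof -
  have M: "monoid_algebra (H \<times>\<times> H) = M"
    by (simp add: DirProd_def monoid_algebra_def)
  have "bilinearity_relations H H = bilinearity_relations A A"
    by (simp add: bilinearity_relations_def)
  then show ?thesis
    by (simp add: fun_eq_iff pure_tensor_def tensor_kernel_def M)
qed

lemma group_like_iff:
  "group_like H l \<longleftrightarrow> l \<in> carrier A \<and> comult H l = tens l l \<and> counit H l = 1"
  by (simp add: group_like_def pure_tensor_H)

lemma group_like_unit:
  assumes "group_like H l"
  shows "l \<in> Units A"
proof -
  have l: "l \<in> carrier A" "comult H l = tens l l" "counit H l = 1"
    using assms by (simp_all add: group_like_iff)
  note bil = antipode_bilinear(2)
  have "l \<otimes>\<^bsub>A\<^esub> S l = \<one>\<^bsub>A\<^esub>"
    using antipode_right[OF l(1)] l tensor_elim_pure[OF A.k_algebra_axioms bil l(1,1)]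
    by (simp add: sweedler2_def)
  then show ?thesis
    using S_mult_group_like[OF l] l(1) unfolding Units_def by (auto intro!: bexI[of _ "S l"])
qed

section \<open>Pairs in involution\<close>

lemma antipode_square_hom: "(\<lambda>h. S (S h)) \<in> algebra_hom A A"
  by (intro algebra_homI linear_mapI) (simp_all add: S_simps)

text \<open>
  Applying \<open>S\<close> twice to \<open>z\<close> conjugates it by \<open>g\<^sup>a\<close>, because the two signs cancel.
\<close>

lemma antipode_square_skew:
  assumes "z \<in> carrier A" "qc A b g z" "S z = \<ominus>\<^bsub>A\<^esub> (z \<otimes>\<^bsub>A\<^esub> gp (- a))"
  shows "S (S z) = (q powi (a * b)) \<odot>\<^bsub>A\<^esub> z"
proof -
  have "S (S z) = (- 1) \<odot>\<^bsub>A\<^esub> S (z \<otimes>\<^bsub>A\<^esub> gp (- a))"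
    using assms(1) unfolding assms(3) by (simp add: A.smult_minus_one[symmetric] S_smult del: A.add.inv_closed)
  also have "\<dots> = (- 1) \<odot>\<^bsub>A\<^esub> (gp a \<otimes>\<^bsub>A\<^esub> ((- 1) \<odot>\<^bsub>A\<^esub> (z \<otimes>\<^bsub>A\<^esub> gp (- a))))"
    using assms(1) by (simp add: S_mult S_gp assms(3) A.smult_minus_one)
  also have "\<dots> = (gp a \<otimes>\<^bsub>A\<^esub> z) \<otimes>\<^bsub>A\<^esub> gp (- a)"
    using assms(1) by (simp add: A.smult_mult_right A.smult_smult A.m_assoc)
  also have "gp a \<otimes>\<^bsub>A\<^esub> z = (q powi (b * a)) \<odot>\<^bsub>A\<^esub> (z \<otimes>\<^bsub>A\<^esub> gp a)"
    using qc_gp_left[OF assms(2,1), of a] by (simp add: q_commute_def)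
  also have "\<dots> \<otimes>\<^bsub>A\<^esub> gp (- a) = (q powi (a * b)) \<odot>\<^bsub>A\<^esub> z"
    using assms(1) by (simp add: A.smult_mult_left A.m_assoc gp_neg_mult mult.commute)
  finally show ?thesis .
qed

text \<open>
  Characters take nilpotent elements to nilpotent elements of a field.
\<close>

lemma character_skew:
  assumes "\<beta> \<in> algebra_hom A field_algebra"
  shows "\<beta> x = 0" "\<beta> y = 0"
proof -
  have "\<beta> z = 0" if "z \<in> carrier A" "z [^]\<^bsub>A\<^esub> (n::nat) = \<zero>\<^bsub>A\<^esub>" for z n
    using algebra_hom_pow[OF A.k_algebra_axioms k_algebra_field assms that(1), of n]
      linear_map_zero[OF A.k_algebra_axioms k_algebra_field algebra_hom_linear_map[OF assms]]
    by (simp add: that(2))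
  then show "\<beta> x = 0" "\<beta> y = 0" using x_nilpotent y_nilpotent by blast+
qed

text \<open>
  The right-hand side of the condition for a pair in involution, as a function of \<open>h\<close>.
\<close>

definition twisted_conjugation where
  "twisted_conjugation l \<beta> = sweedler3 H H
     (\<lambda>h\<^sub>1 h\<^sub>2 h\<^sub>3. (\<beta> h\<^sub>3 * \<beta> (antipode H h\<^sub>1)) \<odot>\<^bsub>H\<^esub> (l \<otimes>\<^bsub>H\<^esub> h\<^sub>2 \<otimes>\<^bsub>H\<^esub> inv\<^bsub>H\<^esub> l))"

text \<open>
  For fixed \<open>h\<^sub>3\<close> the inner Sweedler sum is not multiplicative, but it is \<open>\<beta>(h\<^sub>3)\<close> times the algebra
  endomorphism \<open>\<phi>\<close> with \<open>\<phi>(a) = \<beta>(S a\<^sub>1) l a\<^sub>2 l\<^sup>-\<^sup>1\<close>.  Both \<open>\<phi>\<close> and the outer sum are convolutions of a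
  character with an algebra homomorphism, and these are algebra homomorphisms because scalars are central.
\<close>

lemma twisted_conjugation:
  assumes l: "l \<in> Units A" and \<beta>: "\<beta> \<in> algebra_hom A field_algebra"
  shows twisted_conjugation_hom: "twisted_conjugation l \<beta> \<in> algebra_hom A A"
    and twisted_conjugation_g: "twisted_conjugation l \<beta> g = l \<otimes>\<^bsub>A\<^esub> g \<otimes>\<^bsub>A\<^esub> inv\<^bsub>A\<^esub> l"
    and twisted_conjugation_x:
      "twisted_conjugation l \<beta> x = (\<beta> g powi a11) \<odot>\<^bsub>A\<^esub> (l \<otimes>\<^bsub>A\<^esub> x \<otimes>\<^bsub>A\<^esub> inv\<^bsub>A\<^esub> l)"
    and twisted_conjugation_y:
      "twisted_conjugation l \<beta> y = (\<beta> g powi a21) \<odot>\<^bsub>A\<^esub> (l \<otimes>\<^bsub>A\<^esub> y \<otimes>\<^bsub>A\<^esub> inv\<^bsub>A\<^esub> l)"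
proof -
  have lc: "l \<in> carrier A" "inv\<^bsub>A\<^esub> l \<in> carrier A" using l by auto
  let ?c = "\<lambda>h. l \<otimes>\<^bsub>A\<^esub> h \<otimes>\<^bsub>A\<^esub> inv\<^bsub>A\<^esub> l"
  have c_mult: "?c (a \<otimes>\<^bsub>A\<^esub> b) = ?c a \<otimes>\<^bsub>A\<^esub> ?c b" if "a \<in> carrier A" "b \<in> carrier A" for a b
  proof -
    have "?c a \<otimes>\<^bsub>A\<^esub> ?c b = l \<otimes>\<^bsub>A\<^esub> a \<otimes>\<^bsub>A\<^esub> ((inv\<^bsub>A\<^esub> l \<otimes>\<^bsub>A\<^esub> l) \<otimes>\<^bsub>A\<^esub> (b \<otimes>\<^bsub>A\<^esub> inv\<^bsub>A\<^esub> l))"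
      using that lc by (simp add: A.m_assoc del: A.Units_l_inv)
    then show ?thesis using that lc l by (simp add: A.m_assoc)
  qed
  have c_one: "?c \<one>\<^bsub>A\<^esub> = \<one>\<^bsub>A\<^esub>" using l lc by simp
  note \<beta>s = algebra_homD[OF \<beta>]
  have \<beta>1: "\<beta> \<one>\<^bsub>A\<^esub> = 1" using algebra_hom_one[OF \<beta>] by simp
  let ?f = "\<lambda>h\<^sub>1 h\<^sub>2. \<beta> (S h\<^sub>1) \<odot>\<^bsub>A\<^esub> ?c h\<^sub>2"
  have f: "?f \<in> bilinear_map A A A"
    using lc by (intro bilinear_mapI linear_mapI)
      (simp_all add: S_simps \<beta>s A.l_distr A.r_distr A.smult_mult_left A.smult_mult_right
        A.smult_add_left A.smult_add_right A.smult_smult mult.commute)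
  define \<phi> where "\<phi> = sweedler2 H A ?f"
  have \<phi>: "\<phi> \<in> algebra_hom A A"
    unfolding \<phi>_def using A.k_algebra_axioms f
  proof (rule sweedler_algebra_hom)
    show "?f (a \<otimes>\<^bsub>A\<^esub> a') (b \<otimes>\<^bsub>A\<^esub> b') = ?f a b \<otimes>\<^bsub>A\<^esub> ?f a' b'"
      if "a \<in> carrier A" "a' \<in> carrier A" "b \<in> carrier A" "b' \<in> carrier A" for a a' b b'
      using that lc by (simp only: c_mult) (simp add: S_simps \<beta>s A.smult_mult_left A.smult_mult_right
          A.smult_smult mult.commute)
    show "?f \<one>\<^bsub>A\<^esub> \<one>\<^bsub>A\<^esub> = \<one>\<^bsub>A\<^esub>" by (simp only: c_one S_one \<beta>1 A.smult_one A.one_closed)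
  qed
  note \<phi>s = algebra_homD[OF \<phi>]
  let ?f' = "\<lambda>a h\<^sub>3. \<beta> h\<^sub>3 \<odot>\<^bsub>A\<^esub> \<phi> a"
  have f': "?f' \<in> bilinear_map A A A"
    by (intro bilinear_mapI linear_mapI)
      (simp_all add: \<beta>s \<phi>s A.smult_add_left A.smult_add_right A.smult_smult mult.commute)
  have \<psi>: "sweedler2 H A ?f' \<in> algebra_hom A A"
    using A.k_algebra_axioms f'
    by (rule sweedler_algebra_hom)
      (simp_all add: \<beta>s \<phi>s A.smult_mult_left A.smult_mult_right A.smult_smult mult.commute)
  have inv: "inv\<^bsub>H\<^esub> l = inv\<^bsub>A\<^esub> l" by (simp add: m_inv_def)
  have eq: "twisted_conjugation l \<beta> h = sweedler2 H A ?f' h" if h: "h \<in> carrier A" for h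
  proof -
    have inner: "sweedler2 H A (\<lambda>h\<^sub>1 h\<^sub>2. (\<beta> h\<^sub>3 * \<beta> (S h\<^sub>1)) \<odot>\<^bsub>A\<^esub> ?c h\<^sub>2) a = 1 \<odot>\<^bsub>A\<^esub> ?f' a h\<^sub>3"
      if "a \<in> carrier A" for a h\<^sub>3
    proof -
      have "sweedler2 H A (\<lambda>h\<^sub>1 h\<^sub>2. (\<beta> h\<^sub>3 * \<beta> (S h\<^sub>1)) \<odot>\<^bsub>A\<^esub> ?c h\<^sub>2) a = \<beta> h\<^sub>3 \<odot>\<^bsub>A\<^esub> \<phi> a"
        unfolding \<phi>_def sweedler2_def
        using A.k_algebra_axioms f algebra_hom_closed[OF comult_hom that]
        by (rule tensor_elim_scaled_cong) (use lc in \<open>simp add: A.smult_smult\<close>)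
      then show ?thesis using that by (simp add: \<phi>s)
    qed
    have "twisted_conjugation l \<beta> h = sweedler2 H A (\<lambda>a h\<^sub>3. sweedler2 H A
        (\<lambda>h\<^sub>1 h\<^sub>2. (\<beta> h\<^sub>3 * \<beta> (S h\<^sub>1)) \<odot>\<^bsub>A\<^esub> ?c h\<^sub>2) a) h"
      by (simp add: twisted_conjugation_def sweedler3_def sweedler_H inv)
    also have "\<dots> = 1 \<odot>\<^bsub>A\<^esub> sweedler2 H A ?f' h"
      unfolding sweedler2_def[of H A _ h]
      using A.k_algebra_axioms f' algebra_hom_closed[OF comult_hom h]
      by (rule tensor_elim_scaled_cong) (rule inner)
    finally show ?thesis using h by (simp add: algebra_hom_closed[OF \<psi>])
  qed
  show "twisted_conjugation l \<beta> \<in> algebra_hom A A"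
    using \<psi> by (simp add: algebra_hom_def ring_hom_def Pi_iff eq)
  have \<beta>_inv: "\<beta> g * \<beta> (S g) = 1"
    using \<beta>s(4)[of g "S g"] g_gp_minus_one \<beta>1 by (simp add: S_gen)
  have \<beta>_S_skew: "\<beta> (S z) = 0" if "\<beta> z = 0" "z \<in> carrier A" "S z = \<ominus>\<^bsub>A\<^esub> (z \<otimes>\<^bsub>A\<^esub> gp a)" for z a
    using that by (simp add: A.smult_minus_one[symmetric] \<beta>s del: A.add.inv_closed)
  note sweedler_vals = sweedler_values[OF A.k_algebra_axioms f'] sweedler_values[OF A.k_algebra_axioms f, folded \<phi>_def]
  show "twisted_conjugation l \<beta> g = ?c g"
    using lc \<beta>_inv by (simp add: eq sweedler_vals A.smult_smult)
  show "twisted_conjugation l \<beta> x = (\<beta> g powi a11) \<odot>\<^bsub>A\<^esub> ?c x"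
    using lc l \<phi>s(1)[of x] \<phi>s(1)[of "\<one>\<^bsub>A\<^esub>"] \<beta>_S_skew[OF character_skew(1)[OF \<beta>] gen_closed S_gen(2)]
    by (simp add: eq sweedler_vals character_skew[OF \<beta>] character_gp[OF \<beta>] S_one \<beta>1)
  show "twisted_conjugation l \<beta> y = (\<beta> g powi a21) \<odot>\<^bsub>A\<^esub> ?c y"
    using lc l \<phi>s(1)[of y] \<phi>s(1)[of "\<one>\<^bsub>A\<^esub>"] \<beta>_S_skew[OF character_skew(2)[OF \<beta>] gen_closed S_gen(3)]
    by (simp add: eq sweedler_vals character_skew[OF \<beta>] character_gp[OF \<beta>] S_one \<beta>1)
qed

lemma all_gen_iff: "(\<forall>s. P s) \<longleftrightarrow> P Gen_g \<and> P Gen_x \<and> P Gen_y"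
  by (metis gen.exhaust)

lemma pair_in_involution_iff:
  "pair_in_involution H l \<beta> \<longleftrightarrow> group_like H l \<and> \<beta> \<in> algebra_hom A field_algebra \<and>
     l \<otimes>\<^bsub>A\<^esub> g \<otimes>\<^bsub>A\<^esub> inv\<^bsub>A\<^esub> l = g \<and>
     (\<beta> g powi a11) \<odot>\<^bsub>A\<^esub> (l \<otimes>\<^bsub>A\<^esub> x \<otimes>\<^bsub>A\<^esub> inv\<^bsub>A\<^esub> l) = (q powi (a11 * a12)) \<odot>\<^bsub>A\<^esub> x \<and>
     (\<beta> g powi a21) \<odot>\<^bsub>A\<^esub> (l \<otimes>\<^bsub>A\<^esub> y \<otimes>\<^bsub>A\<^esub> inv\<^bsub>A\<^esub> l) = (q powi (a21 * a22)) \<odot>\<^bsub>A\<^esub> y"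
  (is "_ \<longleftrightarrow> _ \<and> _ \<and> ?gens")
proof -
  have hom_H: "algebra_hom H field_algebra = algebra_hom A field_algebra"
    by (simp add: algebra_hom_def ring_hom_def)
  have "(\<forall>h\<in>carrier A. S (S h) = twisted_conjugation l \<beta> h) \<longleftrightarrow> ?gens"
    if "group_like H l" and \<beta>: "\<beta> \<in> algebra_hom A field_algebra"
  proof -
    have l: "l \<in> Units A" using that(1) by (rule group_like_unit)
    have square: "S (S g) = g" "S (S x) = (q powi (a11 * a12)) \<odot>\<^bsub>A\<^esub> x" "S (S y) = (q powi (a21 * a22)) \<odot>\<^bsub>A\<^esub> y"
      using antipode_square_skew[OF gen_closed gx_commute S_gen(2)]
        antipode_square_skew[OF gen_closed gy_commute S_gen(3)] S_gp[of "- 1"] int_pow_int[of A g 1]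
      by (simp_all add: S_gen)
    have "(\<forall>h\<in>carrier A. S (S h) = twisted_conjugation l \<beta> h) \<longleftrightarrow>
        (\<forall>s. S (S (gen s)) = twisted_conjugation l \<beta> (gen s))"
      using algebra_hom_eqI[OF antipode_square_hom twisted_conjugation_hom[OF l \<beta>]] by blast
    also have "\<dots> \<longleftrightarrow> S (S g) = twisted_conjugation l \<beta> g \<and> S (S x) = twisted_conjugation l \<beta> x \<and>
        S (S y) = twisted_conjugation l \<beta> y"
      by (rule all_gen_iff)
    also have "\<dots> \<longleftrightarrow> ?gens"
      unfolding square twisted_conjugation_g[OF l \<beta>] twisted_conjugation_x[OF l \<beta>]
        twisted_conjugation_y[OF l \<beta>] by metis
    finally show ?thesis .
  qed
  then show ?thesis
    unfolding pair_in_involution_def hom_H twisted_conjugation_def[symmetric] hopf_algebra_simps(1) by blast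
qed

section \<open>Characters, triangular representations and the congruences\<close>

definition character :: "'k \<Rightarrow> (gen list \<Rightarrow>\<^sub>0 'k) set \<Rightarrow> 'k" where
  "character w = descend (free_lift field_algebra (case_gen w 0 0))"

lemma character_hom: "w ^ N = 1 \<Longrightarrow> character w \<in> algebra_hom A field_algebra"
  and character_gen: "w ^ N = 1 \<Longrightarrow> character w (gen s) = (case s of Gen_g \<Rightarrow> w | Gen_x \<Rightarrow> 0 | Gen_y \<Rightarrow> 0)"
  unfolding character_def using universal_property[OF k_algebra_field field_relations] by blast+

lemma counit_eq_character: "counit H = character 1"
  by (simp add: character_def hopf_structure_simps)

text \<open>Characters multiply under convolution, and a group-like element turns convolution into a product.\<close>

lemma character_group_like_mult:
  assumes "group_like H l" "w ^ N = 1" "w' ^ N = 1"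
  shows "character (w * w') l = character w l * character w' l"
proof -
  have l: "l \<in> carrier A" "comult H l = tens l l" using assms(1) by (simp_all add: group_like_iff)
  note hom = character_hom[OF assms(2)] character_hom[OF assms(3)]
  have ww': "(w * w') ^ N = 1" using assms(2,3) by (simp add: power_mult_distrib)
  let ?f = "\<lambda>a b. character w a * character w' b"
  have f: "?f \<in> bilinear_map A A field_algebra"
    by (intro bilinear_mapI linear_mapI)
      (simp_all add: algebra_homD[OF hom(1)] algebra_homD[OF hom(2)] algebra_simps)
  have conv: "sweedler2 H field_algebra ?f \<in> algebra_hom A field_algebra"
    using k_algebra_field f
    by (rule sweedler_algebra_hom) (simp_all add: algebra_homD[OF hom(1)] algebra_homD[OF hom(2)])
  have "character (w * w') l = sweedler2 H field_algebra ?f l"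
    using character_hom[OF ww'] conv _ l(1)
  proof (rule algebra_hom_eqI)
    show "character (w * w') (gen s) = sweedler2 H field_algebra ?f (gen s)" for s
      by (cases s) (simp_all add: sweedler_values[OF k_algebra_field f] character_gen ww' assms)
  qed
  also have "\<dots> = character w l * character w' l"
    using l by (simp add: sweedler2_def tensor_elim_pure[OF k_algebra_field f])
  finally show ?thesis .
qed

lemma character_group_like_powi:
  assumes "group_like H l"
  shows "character q l ^ N = 1" "character (q powi a) l = character q l powi a"
proof -
  have one: "character 1 l = 1"
    using assms by (simp add: group_like_iff counit_eq_character)
  have pow: "character (q ^ n) l = character q l ^ n" for n
  proof (induction n)
    case (Suc n)
    have "(q ^ n) ^ N = 1" by (simp add: q_pow_N power_mult[symmetric] mult.commute[of n])
      (simp add: q_pow_N power_mult)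
    then show ?case
      using character_group_like_mult[OF assms q_pow_N] Suc by simp
  qed (simp add: one)
  show order: "character q l ^ N = 1"
    using pow[of N] by (simp add: q_pow_N one)
  show "character (q powi a) l = character q l powi a"
    unfolding powi_eq_nat_mod[OF q_pow_N N_pos] powi_eq_nat_mod[OF order N_pos] by (rule pow)
qed

lemma upper_triangular_diagonal_pow:
  "(a, 0, c) [^]\<^bsub>upper_triangular\<^esub> (n::nat) = (a ^ n, 0, c ^ n)"
  by (induction n) (simp_all add: nat_pow_def mult.commute)

lemma upper_triangular_nilpotent_pow:
  "2 \<le> n \<Longrightarrow> (0, 1, 0) [^]\<^bsub>upper_triangular\<^esub> (n::nat) = (0, 0, 0 :: 'k)"
  "0 < n \<Longrightarrow> (0, 0, 0) [^]\<^bsub>upper_triangular\<^esub> (n::nat) = (0, 0, 0 :: 'k)"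
proof -
  interpret U: k_algebra "upper_triangular :: ('k, 'k \<times> 'k \<times> 'k) module"
    by (rule k_algebra_upper_triangular)
  have "(0, 1, 0) [^]\<^bsub>upper_triangular\<^esub> Suc (Suc m) = (0, 0, 0 :: 'k)" for m
    by (induction m) simp_all
  then show "2 \<le> n \<Longrightarrow> (0, 1, 0) [^]\<^bsub>upper_triangular\<^esub> (n::nat) = (0, 0, 0 :: 'k)"
    by (metis Suc_1 Suc_le_D Suc_le_mono le_SucE less_eq_nat.simps(1) numeral_2_eq_2)
  show "0 < n \<Longrightarrow> (0, 0, 0) [^]\<^bsub>upper_triangular\<^esub> (n::nat) = (0, 0, 0 :: 'k)"
    using upper_triangular_diagonal_pow[of 0 0 n] by (simp add: zero_power)
qed

text \<open>
  In the representation \<open>\<rho>\<close> the generator \<open>s\<close> acts as the matrix unit with the single entry above the diagonal.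
  The diagonal entries of \<open>\<rho>(l)\<close> are values of characters at \<open>l\<close>: a power of \<open>character q l\<close> and
  \<open>\<epsilon>(l) = 1\<close>.  Comparing the upper right entries of \<open>\<rho>(l s)\<close> and \<open>\<rho>(s l)\<close> turns the commutation of \<open>l\<close> with
  \<open>s\<close> into an equation between scalars, without any knowledge of which elements are group-like.
\<close>

lemma group_like_eigenvalue:
  assumes l: "group_like H l"
    and rel: "satisfies_relations upper_triangular (case_gen (q powi b, 0, 1) u v)"
    and z: "case_gen (q powi b, 0, 1) u v s = (0, 1, 0)"
    and eq: "c \<odot>\<^bsub>A\<^esub> (l \<otimes>\<^bsub>A\<^esub> gen s) = d \<odot>\<^bsub>A\<^esub> (gen s \<otimes>\<^bsub>A\<^esub> l)"
    and uv: "fst u = 0" "fst v = 0" "snd (snd u) = 0" "snd (snd v) = 0"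
  shows "c * character q l powi b = d"
proof -
  have lc: "l \<in> carrier A" using l by (simp add: group_like_iff)
  define \<rho> where "\<rho> = descend (free_lift upper_triangular (case_gen (q powi b, 0, 1) u v))"
  have \<rho>: "\<rho> \<in> algebra_hom A upper_triangular" and gen: "\<rho> (gen t) = case_gen (q powi b, 0, 1) u v t" for t
    unfolding \<rho>_def using universal_property[OF k_algebra_upper_triangular rel] by auto
  have fst: "fst (\<rho> l) = character (q powi b) l"
    using algebra_hom_comp[OF A.k_algebra_axioms \<rho> diagonal_entries_hom(1)]
      character_hom[OF powi_power_eq_1[OF q_pow_N]] _ lc
  proof (rule algebra_hom_eqI)
    show "fst (\<rho> (gen t)) = character (q powi b) (gen t)" for t
      by (cases t) (simp_all add: gen character_gen powi_power_eq_1 q_pow_N uv)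
  qed
  have "snd (snd (\<rho> l)) = character 1 l"
    using algebra_hom_comp[OF A.k_algebra_axioms \<rho> diagonal_entries_hom(2)] character_hom[of 1] _ lc
  proof (rule algebra_hom_eqI)
    show "snd (snd (\<rho> (gen t))) = character 1 (gen t)" for t
      by (cases t) (simp_all add: gen character_gen uv)
  qed simp
  then have snd: "snd (snd (\<rho> l)) = 1"
    using l by (simp add: group_like_iff counit_eq_character)
  obtain m where m: "\<rho> l = (character q l powi b, m, 1)"
    using fst snd character_group_like_powi(2)[OF l] by (metis prod.collapse)
  have "\<rho> (c \<odot>\<^bsub>A\<^esub> (l \<otimes>\<^bsub>A\<^esub> gen s)) = \<rho> (d \<odot>\<^bsub>A\<^esub> (gen s \<otimes>\<^bsub>A\<^esub> l))"
    by (simp only: eq)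
  then show ?thesis
    using lc by (simp add: algebra_homD[OF \<rho>] gen z m)
qed

text \<open>
  The witnesses are \<open>\<zeta> = \<beta>(g)\<close> and the value \<open>\<mu>\<close> of \<open>character q\<close> at \<open>l\<close>.
\<close>

theorem pair_in_involution_necessary:
  assumes "pair_in_involution H l \<beta>"
  shows "\<exists>\<zeta> \<mu>. \<zeta> ^ N = 1 \<and> \<mu> ^ N = 1 \<and> \<zeta> powi a11 * \<mu> powi a12 = q powi (a11 * a12) \<and>
    \<zeta> powi a21 * \<mu> powi a22 = q powi (a21 * a22)"
proof -
  have l: "group_like H l" and \<beta>: "\<beta> \<in> algebra_hom A field_algebra"
    using assms by (simp_all add: pair_in_involution_iff)
  have unit: "l \<in> Units A" using l by (rule group_like_unit)
  have commute: "c \<odot>\<^bsub>A\<^esub> (l \<otimes>\<^bsub>A\<^esub> z) = d \<odot>\<^bsub>A\<^esub> (z \<otimes>\<^bsub>A\<^esub> l)"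
    if eq: "c \<odot>\<^bsub>A\<^esub> (l \<otimes>\<^bsub>A\<^esub> z \<otimes>\<^bsub>A\<^esub> inv\<^bsub>A\<^esub> l) = d \<odot>\<^bsub>A\<^esub> z" and z: "z \<in> carrier A" for c d z
  proof -
    have "(c \<odot>\<^bsub>A\<^esub> (l \<otimes>\<^bsub>A\<^esub> z \<otimes>\<^bsub>A\<^esub> inv\<^bsub>A\<^esub> l)) \<otimes>\<^bsub>A\<^esub> l = (d \<odot>\<^bsub>A\<^esub> z) \<otimes>\<^bsub>A\<^esub> l"
      by (simp only: eq)
    then show ?thesis
      using z unit A.Units_closed[OF unit] by (simp add: A.smult_mult_left A.m_assoc)
  qed
  have N_ge: "2 \<le> Nx" "2 \<le> Ny"
    using additive_order_ge_2[OF N_pos] parameters by (simp_all add: taft_parameters_def)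
  note rel_simps = satisfies_relations_def q_commute_def upper_triangular_diagonal_pow
    upper_triangular_nilpotent_pow powi_power_eq_1 q_pow_N
  have "\<beta> g powi a11 * character q l powi a12 = q powi (a11 * a12)"
  proof (rule group_like_eigenvalue[OF l])
    show "satisfies_relations upper_triangular (case_gen (q powi a12, 0, 1) (0, 1, 0) (0, 0, 0))"
      using N_ge by (simp add: rel_simps)
    show "(\<beta> g powi a11) \<odot>\<^bsub>A\<^esub> (l \<otimes>\<^bsub>A\<^esub> x) = (q powi (a11 * a12)) \<odot>\<^bsub>A\<^esub> (x \<otimes>\<^bsub>A\<^esub> l)"
      using assms by (intro commute) (auto simp: pair_in_involution_iff)
  qed simp_all
  moreover have "\<beta> g powi a21 * character q l powi a22 = q powi (a21 * a22)"
  proof (rule group_like_eigenvalue[OF l])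
    show "satisfies_relations upper_triangular (case_gen (q powi a22, 0, 1) (0, 0, 0) (0, 1, 0))"
      using N_ge by (simp add: rel_simps)
    show "(\<beta> g powi a21) \<odot>\<^bsub>A\<^esub> (l \<otimes>\<^bsub>A\<^esub> y) = (q powi (a21 * a22)) \<odot>\<^bsub>A\<^esub> (y \<otimes>\<^bsub>A\<^esub> l)"
      using assms by (intro commute) (auto simp: pair_in_involution_iff)
  qed simp_all
  ultimately show ?thesis
    using character_gp(2)[OF \<beta>] character_group_like_powi(1)[OF l] by blast
qed

theorem pair_in_involution_sufficient:
  assumes "int N dvd a11 * b + a12 * j - a11 * a12" "int N dvd a21 * b + a22 * j - a21 * a22"
  shows "pair_in_involution H (gp j) (character (q powi b))"
proof -
  have root_b: "(q powi b) ^ N = 1" using q_pow_N by (rule powi_power_eq_1)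
  have "counit H (gp j) = 1"
    using character_gp(1)[OF counit_hom, of j] by (simp add: counit_value)
  then have l: "group_like H (gp j)"
    by (simp add: group_like_iff comult_gp)
  have inv: "inv\<^bsub>A\<^esub> (gp j) = gp (- j)"
    using gp_neg_mult by (intro A.inv_unique'[symmetric]) auto
  have conj: "gp j \<otimes>\<^bsub>A\<^esub> z \<otimes>\<^bsub>A\<^esub> gp (- j) = (q powi (e * j)) \<odot>\<^bsub>A\<^esub> z"
    if "z \<in> carrier A" "qc A e g z" for z e
    using qc_gp_left[OF that(2,1), of j] that(1)
    by (simp add: q_commute_def A.smult_mult_left A.m_assoc gp_neg_mult)
  have eq: "((q powi b) powi a * q powi (e * j)) = q powi (a * e)"
    if "int N dvd a * b + e * j - a * e" for a e
  proof -
    have "(q powi b) powi a * q powi (e * j) = q powi (a * b + e * j)"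
      by (simp add: power_int_mult[symmetric] power_int_add mult.commute)
    then show ?thesis using powi_eqI[OF q_pow_N that] by simp
  qed
  have "gp j \<otimes>\<^bsub>A\<^esub> g \<otimes>\<^bsub>A\<^esub> gp (- j) = g"
    using conj[of g 0] A.q_commute_refl[of g] by simp
  then show ?thesis
    unfolding pair_in_involution_iff inv
    using l character_hom[OF root_b] conj[OF gen_closed gx_commute] conj[OF gen_closed gy_commute]
      eq[OF assms(1)] eq[OF assms(2)]
    by (simp add: character_gen root_b A.smult_smult)
qed

end

section \<open>Two Hopf algebras on the same algebra\<close>

text \<open>
  The coefficient of the relation \<open>x y = q\<^sup>a y x\<close> is given by \<open>a = a\<^sub>1\<^sub>1 a\<^sub>2\<^sub>2\<close>, so changing \<open>a\<^sub>2\<^sub>1\<close> changes at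
  most the nilpotency exponent of \<open>y\<close>.
\<close>

lemma taft_algebra_cong:
  assumes "additive_order N (a21 * a22) = additive_order N (a21' * a22)"
  shows "taft_algebra N q a11 a12 a21 a22 = taft_algebra N q a11 a12 a21' a22"
  using assms by (simp add: taft_algebra_def taft_ideal_def taft_relations_def)

theorem lemma5p1:
  fixes q :: "'k::{alg_closed_field, field_char_0}"
  assumes "primitive_root_of_unity 48 q"
  shows "algebra_isomorphic (taft_hopf 48 q 34 26 4 4) (taft_hopf 48 q 34 26 28 4)
    \<and> (\<exists>l \<beta>. pair_in_involution (taft_hopf 48 q 34 26 28 4) l \<beta>)
    \<and> \<not> (\<exists>l \<beta>. pair_in_involution (taft_hopf 48 q 34 26 4 4) l \<beta>)"
proof (intro conjI)
  interpret H: taft 48 q 34 26 4 4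
    by (intro taft.intro assms taft_parameters_examples)
  interpret L: taft 48 q 34 26 28 4
    by (intro taft.intro assms taft_parameters_examples)
  have same: "H.A = L.A"
    by (rule taft_algebra_cong) (simp add: additive_order_def)
  have "(\<lambda>h. h) \<in> algebra_hom H.H L.H"
    by (intro algebra_homI linear_mapI) (simp_all add: same)
  moreover have "bij_betw (\<lambda>h. h) (carrier H.H) (carrier L.H)"
    by (simp add: same bij_betw_def)
  ultimately show "algebra_isomorphic H.H L.H"
    unfolding algebra_isomorphic_def by blast
  show "\<exists>l \<beta>. pair_in_involution L.H l \<beta>"
    \<comment> \<open>\<open>b = 9\<close>, \<open>j = 13\<close> solves \<open>34 b + 26 j = 20\<close> and \<open>28 b + 4 j = 16\<close> modulo 48.\<close>
    using L.pair_in_involution_sufficient[of 9 13] by auto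
  show "\<not> (\<exists>l \<beta>. pair_in_involution H.H l \<beta>)"
  proof
    assume "\<exists>l \<beta>. pair_in_involution H.H l \<beta>"
    then obtain l \<beta> where "pair_in_involution H.H l \<beta>" by blast
    then obtain \<zeta> \<mu> where orders: "\<zeta> ^ 48 = 1" "\<mu> ^ 48 = 1"
      and eq: "\<zeta> powi 34 * \<mu> powi 26 = q powi (34 * 26)" "\<zeta> powi 4 * \<mu> powi 4 = q powi (4 * 4)"
      using H.pair_in_involution_necessary by blast
    have "(\<zeta> * \<mu>) ^ 12 = (\<zeta> ^ 4 * \<mu> ^ 4) ^ 3"
      by (simp add: power_mult_distrib power_mult[symmetric])
    also have "\<dots> = q ^ 48" using eq(2) by (simp add: power_mult[symmetric])
    also have "\<dots> = 1" using assms by (simp add: primitive_root_of_unity_def)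
    finally have one: "(\<zeta> * \<mu>) ^ 12 = 1" .
    \<comment> \<open>The sixth power turns 34 and 26 into \<open>204\<close> and \<open>156\<close>, both congruent to 12 modulo 48.\<close>
    have "(\<zeta> ^ 34 * \<mu> ^ 26) ^ 6 = (\<zeta> ^ 48) ^ 4 * (\<mu> ^ 48) ^ 3 * (\<zeta> * \<mu>) ^ 12"
      by (simp add: power_mult_distrib power_mult[symmetric] power_add[symmetric] algebra_simps)
    then have six: "(q ^ 884) ^ 6 = 1" using eq(1) one orders by simp
    have order: "q ^ 48 = 1" using assms by (simp add: primitive_root_of_unity_def)
    have "q ^ 24 = (q ^ 48) ^ 110 * q ^ 24" unfolding order by simp
    also have "\<dots> = (q ^ 884) ^ 6" by (simp only: power_mult[symmetric] power_add[symmetric]) simp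
    also have "\<dots> = 1" by (rule six)
    finally have "q ^ 24 = 1" .
    then show False using assms by (simp add: primitive_root_of_unity_def)
  qed
qed

end
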